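(* Let $\kappa \le 0$, let $X$ be a CBB$(\kappa)$ space, let $Y$ be a complete CAT$(\kappa)$ space and let $A \subseteq X$ be nonempty. Then there exists a continuous mapping $\alpha : \mathcal{N}(A,Y) \to \mathcal{N}(X,Y)$ such that for all $g \in \mathcal{N}(A,Y)$, $\alpha(g)(a) = g(a)$ for every $a \in A$.
   Context: For $\kappa\le0$, $M^2_\kappa$ is the complete simply connected surface of constant curvature $\kappa$. A geodesic space is CAT$(\kappa)$ if every geodesic triangle satisfies: distances between points on the triangle are $\le$ distances between corresponding points of its comparison triangle in $M^2_\kappa$; it is CBB$(\kappa)$ if the reversed inequality ($\ge$) holds for all geodesic triangles. $\mathcal{N}(A,Y)$ is the set of bounded nonexpansive ($1$-Lipschitz) maps $A\to Y$, with the supremum metric $d_\infty(f,g)=\sup_{x\in A}d_Y(f(x),g(x))$; continuity of $\alpha$ refers to these metrics. *)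

theory Defs
  imports "HOL-Analysis.Analysis"
begin

definition geodesic_path :: "'a set \<Rightarrow> ('a \<Rightarrow> 'a \<Rightarrow> real) \<Rightarrow> (real \<Rightarrow> 'a) \<Rightarrow> 'a \<Rightarrow> 'a \<Rightarrow> bool" where
  "geodesic_path S d g x y \<longleftrightarrow>
     g 0 = x \<and> g (d x y) = y \<and> (\<forall>s\<in>{0..d x y}. g s \<in> S) \<and>
     (\<forall>s\<in>{0..d x y}. \<forall>t\<in>{0..d x y}. d (g s) (g t) = \<bar>s - t\<bar>)"

definition geodesic_space :: "'a set \<Rightarrow> ('a \<Rightarrow> 'a \<Rightarrow> real) \<Rightarrow> bool" where
  "geodesic_space S d \<longleftrightarrow> (\<forall>x\<in>S. \<forall>y\<in>S. \<exists>g. geodesic_path S d g x y)"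

text \<open>kappa = 0: Euclidean plane, realised as the plane z = 0 in R^3.
  kappa < 0: hyperboloid model {z^2 - x^2 - y^2 = 1, z > 0} with the hyperbolic
  distance scaled by 1/sqrt(-kappa), giving constant curvature kappa.\<close>

definition model_carrier :: "real \<Rightarrow> (real \<times> real \<times> real) set" where
  "model_carrier \<kappa> =
     (if \<kappa> = 0 then {(x, y, z). z = 0}
      else {(x, y, z). z\<^sup>2 - x\<^sup>2 - y\<^sup>2 = 1 \<and> z > 0})"

definition model_dist :: "real \<Rightarrow> real \<times> real \<times> real \<Rightarrow> real \<times> real \<times> real \<Rightarrow> real" where
  "model_dist \<kappa> p q =
     (case p of (x, y, z) \<Rightarrow> case q of (x', y', z') \<Rightarrow>
       (if \<kappa> = 0 then sqrt ((x - x')\<^sup>2 + (y - y')\<^sup>2)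
        else arcosh (z * z' - x * x' - y * y') / sqrt (- \<kappa>)))"

definition triangle_comparison ::
  "'a set \<Rightarrow> ('a \<Rightarrow> 'a \<Rightarrow> real) \<Rightarrow> real \<Rightarrow> (real \<Rightarrow> real \<Rightarrow> bool) \<Rightarrow> bool" where
  "triangle_comparison S d \<kappa> R \<longleftrightarrow>
     (\<forall>p\<in>S. \<forall>q\<in>S. \<forall>r\<in>S. \<forall>g1 g2 g3.
        geodesic_path S d g1 p q \<and> geodesic_path S d g2 q r \<and> geodesic_path S d g3 r p \<longrightarrow>
        (\<forall>p' q' r' h1 h2 h3.
           p' \<in> model_carrier \<kappa> \<and> q' \<in> model_carrier \<kappa> \<and> r' \<in> model_carrier \<kappa> \<and>
           model_dist \<kappa> p' q' = d p q \<and> model_dist \<kappa> q' r' = d q r \<and>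
           model_dist \<kappa> r' p' = d r p \<and>
           geodesic_path (model_carrier \<kappa>) (model_dist \<kappa>) h1 p' q' \<and>
           geodesic_path (model_carrier \<kappa>) (model_dist \<kappa>) h2 q' r' \<and>
           geodesic_path (model_carrier \<kappa>) (model_dist \<kappa>) h3 r' p' \<longrightarrow>
           (\<forall>(g, h, l) \<in> {(g1, h1, d p q), (g2, h2, d q r), (g3, h3, d r p)}.
            \<forall>(g', h', l') \<in> {(g1, h1, d p q), (g2, h2, d q r), (g3, h3, d r p)}.
              \<forall>s\<in>{0..l}. \<forall>t\<in>{0..l'}.
                R (d (g s) (g' t)) (model_dist \<kappa> (h s) (h' t)))))"

definition CAT :: "real \<Rightarrow> 'a::metric_space itself \<Rightarrow> bool" where
  "CAT \<kappa> _ \<longleftrightarrow> geodesic_space (UNIV :: 'a set) dist \<and>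
     triangle_comparison (UNIV :: 'a set) dist \<kappa> (\<lambda>a b. a \<le> b)"

definition CBB :: "real \<Rightarrow> 'a::metric_space itself \<Rightarrow> bool" where
  "CBB \<kappa> _ \<longleftrightarrow> geodesic_space (UNIV :: 'a set) dist \<and>
     triangle_comparison (UNIV :: 'a set) dist \<kappa> (\<lambda>a b. a \<ge> b)"

text \<open>Maps are total HOL functions; only their values on A matter, and the sup
  distance over A is a pseudometric on them.\<close>

definition nonexp_maps :: "'a::metric_space set \<Rightarrow> ('a \<Rightarrow> 'b::metric_space) set" where
  "nonexp_maps A = {f. bounded (f ` A) \<and> (\<forall>x\<in>A. \<forall>y\<in>A. dist (f x) (f y) \<le> dist x y)}"

definition sup_dist :: "'a set \<Rightarrow> ('a \<Rightarrow> 'b::metric_space) \<Rightarrow> ('a \<Rightarrow> 'b) \<Rightarrow> real" where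
  "sup_dist A f g = (SUP x\<in>A. dist (f x) (g x))"

end

theory Submission
  imports Defs
begin

text \<open>
  Write md for the function t^2/2 if \<kappa> = 0 and (cosh (kt) - 1)/k^2 if \<kappa> = -k^2 < 0. In a CBB
  space every convex combination of points x_i with weights w_i satisfies
  \<Sum> w_i w_j md(x_i, x_j) \<le> 2F + k^2 F^2, where F = \<Sum> w_i md(p, x_i) and p is arbitrary, and in a
  CAT space the reverse inequality holds when p minimises F. Comparing the two extends short maps by
  one point (Kirszbraun, Lang and Schroeder), and Zorn's lemma extends them to the whole space.

  The argument only uses the upper bound for the cost md(x_i, x_j), and this bound survives when an
  arbitrary pseudometric is added to the cost. Hence the whole operator is obtained at once: the map
  (g, a) \<mapsto> g a on N(A,Y) \<times> A is short for the cost md(a, a') + \<rho>(g, g') with a suitable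
  pseudometric \<rho> that induces the topology of uniform convergence, and so it extends to
  N(A,Y) \<times> X. Shortness in the second variable makes each \<alpha> g nonexpansive, and shortness
  in the first makes \<alpha> continuous.
\<close>

section \<open>Comparison functions\<close>

text \<open>The bound 2F + k^2 F^2 has a linear model. On the hyperboloid with its Lorentz form, P =
  \<Sum> w_i x_i satisfies <P,P> = 1 + k^2 \<Sum> w_i w_j md(x_i, x_j) and <p,P> = 1 + k^2 F, so the
  bound is the reversed Cauchy-Schwarz inequality <p,P>^2 \<ge> <P,P>. A pseudometric may be added
  to the cost because \<rho>(x_i, x_j) \<le> \<rho>(x_i, p) + \<rho>(p, x_j): the left side gains at
  most twice what F gains, the right side at least that. The uniform distance, even multiplied by a
  constant, cannot serve as \<rho> in general. Since md grows faster than linearly, moving a value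
  by \<delta> changes md by about \<delta> times its derivative at the distance of the values, and
  this derivative is unbounded over N(A,Y). Hence \<rho> carries a weight that grows with the size
  of the maps, where size means uniform distance to a fixed constant map. The constant map also
  gives boundedness: its extension is prescribed to be constant, and every other extended map stays
  within a bounded distance of it.\<close>

definition md :: "real \<Rightarrow> real \<Rightarrow> real" where
  "md k t = (if k = 0 then t\<^sup>2 / 2 else (cosh (k * t) - 1) / k\<^sup>2)"

text \<open>The derivative of \<open>md k\<close>. Along a unit speed geodesic of the model plane,
  \<open>md k\<close> of the distance to a fixed point solves y'' = 1 + k^2 y; \<open>sn k\<close>
  is the solution of y'' = k^2 y with value 0 and slope 1 at 0.\<close>

definition sn :: "real \<Rightarrow> real \<Rightarrow> real" where
  "sn k t = (if k = 0 then t else sinh (k * t) / k)"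

lemma cosh_eq_md: "cosh (k * t) = 1 + k\<^sup>2 * md k t"
  by (simp add: md_def)

lemma md_0 [simp]: "md k 0 = 0" and sn_0 [simp]: "sn k 0 = 0"
  by (simp_all add: md_def sn_def)

lemma md_minus [simp]: "md k (- t) = md k t"
  by (simp add: md_def)

lemma DERIV_md [derivative_intros]:
  assumes "(f has_real_derivative D) (at x within s)"
  shows "((\<lambda>x. md k (f x)) has_real_derivative (sn k (f x) * D)) (at x within s)"
  using assms unfolding md_def sn_def
  by (cases "k = 0") (auto intro!: derivative_eq_intros simp: field_simps power2_eq_square)

lemma DERIV_sn [derivative_intros]:
  assumes "(f has_real_derivative D) (at x within s)"
  shows "((\<lambda>x. sn k (f x)) has_real_derivative (cosh (k * f x) * D)) (at x within s)"
  using assms unfolding sn_def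
  by (cases "k = 0") (auto intro!: derivative_eq_intros simp: field_simps)

lemma continuous_on_md [continuous_intros]:
  "continuous_on s f \<Longrightarrow> continuous_on s (\<lambda>x. md k (f x))"
  unfolding md_def by (cases "k = 0") (auto intro!: continuous_intros)

lemma md_nonneg [simp]: "0 \<le> md k t"
  by (simp add: md_def cosh_real_ge_1)

lemma sn_add: "sn k (s + t) = sn k s * cosh (k * t) + cosh (k * s) * sn k t"
  by (simp add: sn_def sinh_add ring_distribs add_divide_distrib)

lemma md_add: "md k (s + t) = md k s * cosh (k * t) + md k t + sn k s * sn k t"
  by (simp add: md_def sn_def cosh_add ring_distribs field_simps power2_eq_square)

lemma sn_double: "sn k (2 * t) = 2 * sn k t * cosh (k * t)"
  using sn_add[of k t t] by simp

lemma sn_sq: "(sn k t)\<^sup>2 = 2 * md k t + k\<^sup>2 * (md k t)\<^sup>2"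
proof (cases "k = 0")
  case False
  have "k\<^sup>2 * (sn k t)\<^sup>2 = (cosh (k * t))\<^sup>2 - 1"
    using False by (simp add: sn_def power_divide cosh_square_eq)
  also have "\<dots> = k\<^sup>2 * (2 * md k t + k\<^sup>2 * (md k t)\<^sup>2)" unfolding cosh_eq_md by algebra
  finally show ?thesis using False by simp
qed (simp add: md_def sn_def)

text \<open>Both \<open>cosh (k * t)\<close> and \<open>md k (l - t) - md k t\<close> solve y'' =
  k^2 y in t, so on [0, l] they are the \<open>sn\<close> interpolations of their end values.
  Algebraically, each defect is a combination of instances of \<open>sn_sq\<close>.\<close>

lemma sn_md_interpolate:
  shows "sn k l * (1 + k\<^sup>2 * md k t) = sn k (l - t) + sn k t + k\<^sup>2 * sn k t * md k l"
    and "sn k l * (md k (l - t) - md k t) = (sn k (l - t) - sn k t) * md k l"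
proof -
  define s s' m m' L M where "s = sn k t" "s' = sn k (l - t)" "m = md k t" "m' = md k (l - t)"
    "L = sn k l" "M = md k l"
  note defs = this
  have L: "L = s' * (1 + k\<^sup>2 * m) + (1 + k\<^sup>2 * m') * s"
    using sn_add[of k "l - t" t] by (simp add: defs cosh_eq_md)
  have M: "M = m' * (1 + k\<^sup>2 * m) + m + s' * s"
    using md_add[of k "l - t" t] by (simp add: defs cosh_eq_md)
  have s: "s\<^sup>2 - (2 * m + k\<^sup>2 * m\<^sup>2) = 0" "s'\<^sup>2 - (2 * m' + k\<^sup>2 * m'\<^sup>2) = 0"
    by (simp_all add: defs sn_sq)
  have "L * (1 + k\<^sup>2 * m) - (s' + s + k\<^sup>2 * s * M) = - s' * k\<^sup>2 * (s\<^sup>2 - (2 * m + k\<^sup>2 * m\<^sup>2))"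
    by (simp add: L M algebra_simps power2_eq_square)
  thus "sn k l * (1 + k\<^sup>2 * md k t) = sn k (l - t) + sn k t + k\<^sup>2 * sn k t * md k l"
    unfolding s by (simp add: defs)
  have "L * (m' - m) - (s' - s) * M = s' * (s\<^sup>2 - (2 * m + k\<^sup>2 * m\<^sup>2)) - s * (s'\<^sup>2 - (2 * m' + k\<^sup>2 * m'\<^sup>2))"
    by (simp add: L M algebra_simps power2_eq_square)
  thus "sn k l * (md k (l - t) - md k t) = (sn k (l - t) - sn k t) * md k l"
    unfolding s by (simp add: defs)
qed

lemma md_double: "md k (2 * t) = 2 * md k t * (1 + cosh (k * t))"
  using md_add[of k t t] sn_sq[of k t] by (simp add: cosh_eq_md algebra_simps power2_eq_square)

lemma sn_mono: "s \<le> t \<Longrightarrow> sn k s \<le> sn k t"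
  by (rule DERIV_nonneg_imp_nondecreasing[of s t "sn k"])
     (auto intro!: exI derivative_eq_intros)

lemma sn_ge: assumes "0 \<le> t" shows "t \<le> sn k t"
proof -
  have "sn k 0 - 0 \<le> sn k t - t"
    by (rule DERIV_nonneg_imp_nondecreasing[OF assms, of "\<lambda>t. sn k t - t"])
       (auto intro!: exI derivative_eq_intros simp: cosh_real_ge_1)
  thus ?thesis by simp
qed

lemma sn_nonneg: "0 \<le> t \<Longrightarrow> 0 \<le> sn k t" and sn_pos: "0 < t \<Longrightarrow> 0 < sn k t"
  using sn_ge[of t k] by auto

text \<open>Convexity of \<open>md k\<close>, from its nondecreasing derivative \<open>sn k\<close>.
  This is the bridge in both directions between estimates of \<open>md\<close> and estimates of
  distances.\<close>

lemma md_tangent: "md k s + sn k s * (t - s) \<le> md k t"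
proof (cases "s \<le> t")
  case True
  have "md k s - sn k s * s \<le> md k t - sn k s * t"
    by (rule DERIV_nonneg_imp_nondecreasing[OF True, of "\<lambda>t. md k t - sn k s * t"])
       (auto intro!: exI derivative_eq_intros sn_mono)
  thus ?thesis by (simp add: algebra_simps)
next
  case False
  hence "t \<le> s" by simp
  hence "md k t - sn k s * t \<ge> md k s - sn k s * s"
    by (rule DERIV_nonpos_imp_nonincreasing[of t s "\<lambda>t. md k t - sn k s * t"])
       (auto intro!: exI derivative_eq_intros sn_mono)
  thus ?thesis by (simp add: algebra_simps)
qed

lemma md_strict_mono: assumes "0 \<le> s" "s < t" shows "md k s < md k t"
proof (cases "s = 0")
  case True
  have "md k (t/2) + sn k (t/2) * (t - t/2) \<le> md k t" by (rule md_tangent)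
  moreover have "0 < sn k (t/2) * (t - t/2)" using assms sn_pos[of "t/2" k] by auto
  ultimately have "0 < md k t" using md_nonneg[of k "t/2"] by linarith
  thus ?thesis using True by simp
next
  case False
  have "0 < sn k s * (t - s)" using False assms sn_pos[of s k] by simp
  thus ?thesis using md_tangent[of k s t] by simp
qed

lemma md_le_iff: "0 \<le> s \<Longrightarrow> 0 \<le> t \<Longrightarrow> md k s \<le> md k t \<longleftrightarrow> s \<le> t"
  using md_strict_mono[of s t k] md_strict_mono[of t s k] by (cases s t rule: linorder_cases) auto

lemma md_mono: "0 \<le> s \<Longrightarrow> s \<le> t \<Longrightarrow> md k s \<le> md k t"
  using md_le_iff[of s t k] by auto

lemma md_eq_0_iff: "0 \<le> t \<Longrightarrow> md k t = 0 \<longleftrightarrow> t = 0"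
  using md_strict_mono[of 0 t k] by (cases "t = 0") auto

lemma md_le_mult_sn: "md k t \<le> t * sn k t"
  using md_tangent[of k t 0] by (simp add: algebra_simps)

lemma md_ge: "t\<^sup>2 / 2 \<le> md k t"
proof -
  have *: "t\<^sup>2 / 2 \<le> md k t" if "0 \<le> t" for t
  proof -
    have "md k 0 - 0\<^sup>2/2 \<le> md k t - t\<^sup>2/2"
      by (rule DERIV_nonneg_imp_nondecreasing[OF that, of "\<lambda>t. md k t - t\<^sup>2/2"])
         (auto intro!: exI derivative_eq_intros sn_ge)
    thus ?thesis by simp
  qed
  show ?thesis using *[of t] *[of "-t"] by (cases "0 \<le> t") auto
qed

lemma cosh_mono: "0 \<le> s \<Longrightarrow> s \<le> t \<Longrightarrow> cosh (k * s) \<le> cosh (k * t)" for k :: real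
  unfolding cosh_eq_md by (simp add: md_mono mult_left_mono)

text \<open>The left side is at most \<open>s * cosh (k * t)\<close>, since cosh is largest at the
  right end of the interval; then \<open>s \<le> sn k s\<close> puts it in the shape that the
  comparison inequality produces.\<close>

lemma sn_diff_le:
  assumes "0 \<le> s" "s \<le> t"
  shows "sn k t - sn k (t - s) \<le> sn k s * cosh (k * t)"
proof -
  have "(t - s) * cosh (k * t) - sn k (t - s) \<le> t * cosh (k * t) - sn k t"
    by (rule DERIV_nonneg_imp_nondecreasing[of "t - s" t "\<lambda>u. u * cosh (k * t) - sn k u"])
       (use assms in \<open>auto intro!: exI derivative_eq_intros cosh_mono\<close>)
  moreover have "s * cosh (k * t) \<le> sn k s * cosh (k * t)"
    using sn_ge[OF assms(1)] by (intro mult_right_mono) auto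
  moreover have "(t - s) * cosh (k * t) = t * cosh (k * t) - s * cosh (k * t)"
    by (simp add: left_diff_distrib)
  ultimately show ?thesis by linarith
qed

section \<open>Comparison triangles\<close>

text \<open>The Lorentz form, with the sign for which points of the hyperboloid have square
  1.\<close>

definition mform :: "real \<times> real \<times> real \<Rightarrow> real \<times> real \<times> real \<Rightarrow> real" where
  "mform p q = (case p of (x, y, z) \<Rightarrow> case q of (x', y', z') \<Rightarrow> z * z' - x * x' - y * y')"

lemma mform_add_right: "mform p (q + r) = mform p q + mform p r"
  and mform_scale_right: "mform p (c *\<^sub>R q) = c * mform p q"
  by (auto simp: mform_def algebra_simps split: prod.splits)

lemma mform_comb:
  "mform (a *\<^sub>R u + b *\<^sub>R v) (c *\<^sub>R u + d *\<^sub>R v) =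
     a * c * mform u u + (a * d + b * c) * mform u v + b * d * mform v v"
  by (auto simp: mform_def algebra_simps split: prod.splits)

text \<open>Reversed Cauchy-Schwarz, by Lagrange's identity for (1, x, y) and (1, x', y'). It puts
  the form into the range where \<open>arcosh\<close> inverts \<open>cosh\<close>.\<close>

lemma mform_ge_1:
  assumes "\<kappa> < 0" "u \<in> model_carrier \<kappa>" "v \<in> model_carrier \<kappa>"
  shows "mform u v \<ge> 1"
proof -
  obtain x y z x' y' z' where uv: "u = (x, y, z)" "v = (x', y', z')" by (metis prod_cases3)
  have z: "z\<^sup>2 = 1 + x\<^sup>2 + y\<^sup>2" "z > 0" "z'\<^sup>2 = 1 + x'\<^sup>2 + y'\<^sup>2" "z' > 0"
    using assms by (auto simp: uv model_carrier_def)
  have "(1 + x * x' + y * y')\<^sup>2 \<le> (1 + x\<^sup>2 + y\<^sup>2) * (1 + x'\<^sup>2 + y'\<^sup>2)"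
  proof -
    have "0 \<le> (x - x')\<^sup>2 + (y - y')\<^sup>2 + (x * y' - y * x')\<^sup>2" by simp
    thus ?thesis by (simp add: algebra_simps power2_eq_square)
  qed
  also have "\<dots> = (z * z')\<^sup>2" by (simp add: power_mult_distrib z)
  finally have "1 + x * x' + y * y' \<le> z * z'"
    by (rule power2_le_imp_le) (use z(2,4) in simp)
  thus ?thesis by (simp add: mform_def uv)
qed

lemma model_dist_hyp: "\<kappa> < 0 \<Longrightarrow> model_dist \<kappa> u v = arcosh (mform u v) / sqrt (- \<kappa>)"
  by (auto simp: model_dist_def mform_def split: prod.splits)

lemma mform_eq_cosh:
  assumes "\<kappa> < 0" "u \<in> model_carrier \<kappa>" "v \<in> model_carrier \<kappa>"
  shows "mform u v = cosh (sqrt (- \<kappa>) * model_dist \<kappa> u v)" "0 \<le> model_dist \<kappa> u v"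
  using assms mform_ge_1[OF assms]
  by (simp_all add: model_dist_hyp arcosh_nonneg_real)

lemma model_dist_eqI:
  assumes "\<kappa> < 0" "mform u v = cosh (sqrt (- \<kappa>) * a)" "0 \<le> a"
  shows "model_dist \<kappa> u v = a"
  using assms by (simp add: model_dist_hyp arcosh_cosh_real)

lemma mform_self:
  assumes "\<kappa> < 0" "u \<in> model_carrier \<kappa>"
  shows "mform u u = 1"
  using assms by (auto simp: mform_def model_carrier_def power2_eq_square)

text \<open>The geodesic of length l from u to v at arc length t, written linearly in the ambient
  space; for k = 0 it is the usual affine segment, so one formula serves both models.\<close>

definition model_segment :: "real \<Rightarrow> real \<Rightarrow> real \<times> real \<times> real \<Rightarrow> real \<times> real \<times> real \<Rightarrow>
    real \<Rightarrow> real \<times> real \<times> real" where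
  "model_segment k l u v t = (sn k (l - t) / sn k l) *\<^sub>R u + (sn k t / sn k l) *\<^sub>R v"

text \<open>The form is linear in the point of the segment, so \<open>cosh\<close> of the scaled
  distance to p is interpolated by \<open>sn\<close>. Subtracting the interpolation of
  \<open>cosh (k * t)\<close> removes the constant 1 and leaves an identity for
  \<open>md\<close>.\<close>

lemma model_segment_hyp:
  assumes "\<kappa> < 0" "u \<in> model_carrier \<kappa>" "v \<in> model_carrier \<kappa>"
    and l: "model_dist \<kappa> u v = l" "0 < l" and k: "k = sqrt (- \<kappa>)"
  shows "geodesic_path (model_carrier \<kappa>) (model_dist \<kappa>) (model_segment k l u v) u v"
    and "p \<in> model_carrier \<kappa> \<Longrightarrow> t \<in> {0..l} \<Longrightarrow>
      sn k l * (md k (model_dist \<kappa> p (model_segment k l u v t)) - md k t)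
      = sn k (l - t) * md k (model_dist \<kappa> p u) + sn k t * (md k (model_dist \<kappa> p v) - md k l)"
    and "p \<in> model_carrier \<kappa> \<Longrightarrow> t \<in> {0..l} \<Longrightarrow> 0 \<le> model_dist \<kappa> p (model_segment k l u v t)"
proof -
  have k0: "k > 0" using assms by simp
  have sl: "sn k l > 0" using l sn_pos by simp
  have uv: "mform u v = cosh (k * l)" using mform_eq_cosh[OF assms(1-3)] l k by simp
  note self = mform_self[OF assms(1,2)] mform_self[OF assms(1,3)]
  let ?h = "model_segment k l u v"
  have form: "mform (?h s) (?h t) = cosh (k * (s - t))" for s t
  proof -
    have e: "sinh (k * l) \<noteq> 0" using sl k0 by (auto simp: sn_def)
    define a b L where "a = k * s" and "b = k * t" and "L = k * l"
    have c: "cosh L * cosh L = 1 + sinh L * sinh L"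
      using cosh_square_eq[of L] by (simp add: power2_eq_square)
    have c1: "cosh L * cosh L * x = x + sinh L * sinh L * x" for x
      by (simp add: c algebra_simps)
    have "sinh (L - a) * sinh (L - b) + (sinh (L - a) * sinh b + sinh a * sinh (L - b)) * cosh L
        + sinh a * sinh b = sinh L * sinh L * cosh (a - b)"
      by (simp add: sinh_diff cosh_diff algebra_simps) (use c1[of "sinh a * sinh b"] in \<open>simp add: algebra_simps\<close>)
    hence "mform (?h s) (?h t) * (sinh L * sinh L) = sinh L * sinh L * cosh (a - b)"
      using k0 e unfolding model_segment_def mform_comb self uv
      by (simp add: sn_def a_def b_def L_def field_simps right_diff_distrib)
    thus ?thesis using e by (simp add: a_def b_def L_def right_diff_distrib)
  qed
  have car: "?h t \<in> model_carrier \<kappa>" if t: "t \<in> {0..l}" for t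
  proof -
    obtain x y z where h: "?h t = (x, y, z)" by (metis prod_cases3)
    have "z * z - x * x - y * y = 1" using form[of t t] by (simp add: mform_def h)
    moreover have "z > 0"
    proof -
      obtain x1 y1 z1 x2 y2 z2 where e: "u = (x1, y1, z1)" "v = (x2, y2, z2)" by (metis prod_cases3)
      have p: "z1 > 0" "z2 > 0" using assms by (auto simp: e model_carrier_def)
      have z: "z = (sn k (l - t) / sn k l) * z1 + (sn k t / sn k l) * z2"
        using h by (simp add: model_segment_def e)
      show ?thesis
      proof (cases "t = 0")
        case True thus ?thesis using z p sl by simp
      next
        case False
        hence "sn k t > 0" "sn k (l - t) \<ge> 0" using t sn_pos[of t k] sn_nonneg[of "l - t" k] by auto
        thus ?thesis unfolding z using p sl by (intro add_nonneg_pos) auto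
      qed
    qed
    ultimately show ?thesis using assms(1) h by (simp add: model_carrier_def power2_eq_square)
  qed
  have d: "model_dist \<kappa> (?h s) (?h t) = \<bar>s - t\<bar>" for s t
  proof (rule model_dist_eqI[OF assms(1)])
    show "mform (?h s) (?h t) = cosh (sqrt (- \<kappa>) * \<bar>s - t\<bar>)"
      using form[of s t] k0 k by (cases "s \<ge> t") (auto simp: abs_if algebra_simps cosh_minus[of "k * (s - t)", symmetric])
  qed simp
  show "geodesic_path (model_carrier \<kappa>) (model_dist \<kappa>) ?h u v"
    unfolding geodesic_path_def using car d sl l by (auto simp: model_segment_def)
  assume p: "p \<in> model_carrier \<kappa>" and t: "t \<in> {0..l}"
  show "0 \<le> model_dist \<kappa> p (?h t)" using mform_eq_cosh(2)[OF assms(1) p car[OF t]] .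
  have "sn k l * mform p (?h t) = sn k (l - t) * mform p u + sn k t * mform p v"
    using sl by (simp add: model_segment_def mform_add_right mform_scale_right field_simps)
  hence "sn k l * (1 + k\<^sup>2 * md k (model_dist \<kappa> p (?h t)))
     = sn k (l - t) * (1 + k\<^sup>2 * md k (model_dist \<kappa> p u)) + sn k t * (1 + k\<^sup>2 * md k (model_dist \<kappa> p v))"
    using mform_eq_cosh(1)[OF assms(1) p] car[OF t] assms(2,3)
    by (simp add: k[symmetric] cosh_eq_md)
  hence "k\<^sup>2 * (sn k l * (md k (model_dist \<kappa> p (?h t)) - md k t))
     = k\<^sup>2 * (sn k (l - t) * md k (model_dist \<kappa> p u) + sn k t * (md k (model_dist \<kappa> p v) - md k l))"
    using sn_md_interpolate(1)[of k l t] by (simp add: algebra_simps)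
  thus "sn k l * (md k (model_dist \<kappa> p (?h t)) - md k t)
     = sn k (l - t) * md k (model_dist \<kappa> p u) + sn k t * (md k (model_dist \<kappa> p v) - md k l)"
    using k0 by simp
qed

lemma model_dist_euc: "model_dist 0 (x, y, z) (x', y', z') = sqrt ((x - x')\<^sup>2 + (y - y')\<^sup>2)"
  by (simp add: model_dist_def)

lemma model_segment_euc:
  assumes "u \<in> model_carrier 0" "v \<in> model_carrier 0" and l: "model_dist 0 u v = l" "0 < l"
  shows "geodesic_path (model_carrier 0) (model_dist 0) (model_segment 0 l u v) u v"
    and "p \<in> model_carrier 0 \<Longrightarrow> t \<in> {0..l} \<Longrightarrow>
      sn 0 l * (md 0 (model_dist 0 p (model_segment 0 l u v t)) - md 0 t)
      = sn 0 (l - t) * md 0 (model_dist 0 p u) + sn 0 t * (md 0 (model_dist 0 p v) - md 0 l)"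
    and "0 \<le> model_dist 0 p q"
proof -
  obtain x y x' y' where uv: "u = (x, y, 0)" "v = (x', y', 0)"
    using assms by (auto simp: model_carrier_def)
  have l2: "(x - x')\<^sup>2 + (y - y')\<^sup>2 = l\<^sup>2" using l by (simp add: uv model_dist_euc)
       (metis real_sqrt_pow2 sum_power2_ge_zero)
  have h: "model_segment 0 l u v t = (x + t / l * (x' - x), y + t / l * (y' - y), 0)" for t
    using l by (simp add: model_segment_def uv sn_def field_simps)
  have d: "model_dist 0 (model_segment 0 l u v s) (model_segment 0 l u v t) = \<bar>s - t\<bar>" for s t
  proof -
    have "(x + s / l * (x' - x) - (x + t / l * (x' - x)))\<^sup>2 + (y + s / l * (y' - y) - (y + t / l * (y' - y)))\<^sup>2
      = (s / l - t / l)\<^sup>2 * ((x - x')\<^sup>2 + (y - y')\<^sup>2)" by algebra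
    also have "\<dots> = (s - t)\<^sup>2" using l unfolding l2 by (simp add: field_simps power2_eq_square)
    finally show ?thesis by (simp add: h model_dist_euc)
  qed
  show "geodesic_path (model_carrier 0) (model_dist 0) (model_segment 0 l u v) u v"
    unfolding geodesic_path_def h l(1) using d[unfolded h] l(2) by (auto simp: uv model_carrier_def)
  show "0 \<le> model_dist 0 p q" by (auto simp: model_dist_def split: prod.splits)
  assume "p \<in> model_carrier 0" and t: "t \<in> {0..l}"
  then obtain a b where p: "p = (a, b, 0)" by (auto simp: model_carrier_def)
  define c where "c = t / l"
  have t: "t = c * l" using l by (simp add: c_def)
  \<comment> \<open>Stewart's theorem for the point that divides the segment in the ratio c : 1 -
    c.\<close>
  have "(a - (x + c * (x' - x)))\<^sup>2 + (b - (y + c * (y' - y)))\<^sup>2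
    = (1 - c) * ((a - x)\<^sup>2 + (b - y)\<^sup>2) + c * ((a - x')\<^sup>2 + (b - y')\<^sup>2) - c * (1 - c) * ((x - x')\<^sup>2 + (y - y')\<^sup>2)"
    by algebra
  moreover have "md 0 (model_dist 0 p (model_segment 0 l u v t))
      = ((a - (x + c * (x' - x)))\<^sup>2 + (b - (y + c * (y' - y)))\<^sup>2) / 2"
    by (simp add: h c_def[symmetric] p model_dist_euc md_def)
  moreover have "md 0 (model_dist 0 p u) = ((a - x)\<^sup>2 + (b - y)\<^sup>2) / 2"
    "md 0 (model_dist 0 p v) = ((a - x')\<^sup>2 + (b - y')\<^sup>2) / 2"
    by (simp_all add: uv p model_dist_euc md_def)
  ultimately have X: "md 0 (model_dist 0 p (model_segment 0 l u v t))
    = (1 - c) * md 0 (model_dist 0 p u) + c * md 0 (model_dist 0 p v) - c * (1 - c) * l\<^sup>2 / 2"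
    unfolding l2 by (simp only:) (simp add: field_simps)
  show "sn 0 l * (md 0 (model_dist 0 p (model_segment 0 l u v t)) - md 0 t)
      = sn 0 (l - t) * md 0 (model_dist 0 p u) + sn 0 t * (md 0 (model_dist 0 p v) - md 0 l)"
  proof -
    have "l * ((1 - c) * P + c * Q - c * (1 - c) * l\<^sup>2 / 2 - (c * l)\<^sup>2 / 2)
      = (l - c * l) * P + c * l * (Q - l\<^sup>2 / 2)" for P Q
      by (simp add: field_simps power2_eq_square)
    moreover have "md 0 t = (c * l)\<^sup>2 / 2" "md 0 l = l\<^sup>2 / 2" by (simp_all add: md_def t)
    ultimately show ?thesis using X by (simp only: sn_def if_True simp_thms t)
  qed
qed

text \<open>The vertex q sits at the origin of the model, r on the first axis, and p in the
  direction whose cosine \<open>co\<close> the law of cosines dictates. The triangle inequalities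
  are what places \<open>co\<close> between -1 and 1.\<close>

lemma model_triangle_exists:
  assumes "\<kappa> \<le> 0" and pos: "0 < a" "0 < b" "0 < c" and tri: "a \<le> b + c" "b \<le> a + c" "c \<le> a + b"
  obtains p q r where "p \<in> model_carrier \<kappa>" "q \<in> model_carrier \<kappa>" "r \<in> model_carrier \<kappa>"
    "model_dist \<kappa> p q = b" "model_dist \<kappa> q r = a" "model_dist \<kappa> r p = c"
proof (cases "\<kappa> = 0")
  case True
  define co where "co = (a\<^sup>2 + b\<^sup>2 - c\<^sup>2) / (2 * a * b)"
  have co: "2 * a * b * co = a\<^sup>2 + b\<^sup>2 - c\<^sup>2" using pos by (simp add: co_def)
  have "co \<le> 1"
  proof -
    have "(a - b)\<^sup>2 \<le> c\<^sup>2" using tri pos by (intro abs_le_square_iff[THEN iffD1]) auto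
    thus ?thesis using pos by (simp add: co_def power2_eq_square algebra_simps)
  qed
  moreover have "-1 \<le> co"
  proof -
    have "c\<^sup>2 \<le> (a + b)\<^sup>2" using tri pos by (intro power_mono) auto
    thus ?thesis using pos by (simp add: co_def power2_eq_square field_simps)
  qed
  ultimately have "co\<^sup>2 \<le> 1" by (simp add: abs_square_le_1)
  define si where "si = sqrt (1 - co\<^sup>2)"
  have si: "co\<^sup>2 + si\<^sup>2 = 1" using \<open>co\<^sup>2 \<le> 1\<close> by (simp add: si_def)
  have "(b * co)\<^sup>2 + (b * si)\<^sup>2 = b\<^sup>2" using si by algebra
  moreover have "(a - b * co)\<^sup>2 + (0 - b * si)\<^sup>2 = c\<^sup>2" using si co by algebra
  ultimately show ?thesis using pos True
    by (intro that[of "(b * co, b * si, 0)" "(0, 0, 0)" "(a, 0, 0)"])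
       (simp_all add: model_carrier_def model_dist_euc)
next
  case False
  hence neg: "\<kappa> < 0" using assms by simp
  define k where "k = sqrt (- \<kappa>)"
  define A B C where "A = k * a" and "B = k * b" and "C = k * c"
  have k: "k > 0" using neg by (simp add: k_def)
  have P: "0 < sinh A" "0 < sinh B" using k pos by (auto simp: A_def B_def)
  define co where "co = (cosh A * cosh B - cosh C) / (sinh A * sinh B)"
  have co: "sinh A * sinh B * co = cosh A * cosh B - cosh C" using P by (simp add: co_def)
  have "co \<le> 1"
  proof -
    have "cosh (A - B) = cosh (k * \<bar>a - b\<bar>)"
      using k by (cases "a \<ge> b") (auto simp: A_def B_def abs_if algebra_simps cosh_minus[of "k * (a - b)", symmetric])
    also have "\<dots> \<le> cosh C" unfolding C_def using tri by (intro cosh_mono) auto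
    finally show ?thesis using P by (simp add: co_def cosh_diff)
  qed
  moreover have "-1 \<le> co"
  proof -
    have "cosh C \<le> cosh (k * (a + b))" unfolding C_def using tri pos by (intro cosh_mono) auto
    also have "\<dots> = cosh A * cosh B + sinh A * sinh B" by (simp add: A_def B_def ring_distribs cosh_add)
    finally show ?thesis using P by (simp add: co_def field_simps)
  qed
  ultimately have "co\<^sup>2 \<le> 1" by (simp add: abs_square_le_1)
  define si where "si = sqrt (1 - co\<^sup>2)"
  have si: "co\<^sup>2 + si\<^sup>2 = 1" using \<open>co\<^sup>2 \<le> 1\<close> by (simp add: si_def)
  have hA: "(cosh A)\<^sup>2 - (sinh A)\<^sup>2 = 1" and hB: "(cosh B)\<^sup>2 - (sinh B)\<^sup>2 = 1"
    by (simp_all add: hyperbolic_pythagoras)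
  have "(cosh B)\<^sup>2 - (sinh B * co)\<^sup>2 - (sinh B * si)\<^sup>2 = 1" using hB si by algebra
  moreover have "model_dist \<kappa> (sinh B * co, sinh B * si, cosh B) (0, 0, 1) = b"
    using pos by (intro model_dist_eqI[OF neg]) (auto simp: mform_def B_def k_def)
  moreover have "model_dist \<kappa> (0, 0, 1) (sinh A, 0, cosh A) = a"
    using pos by (intro model_dist_eqI[OF neg]) (auto simp: mform_def A_def k_def)
  moreover have "model_dist \<kappa> (sinh A, 0, cosh A) (sinh B * co, sinh B * si, cosh B) = c"
    using pos co by (intro model_dist_eqI[OF neg]) (auto simp: mform_def k_def[symmetric] C_def[symmetric])
  ultimately show ?thesis using neg hA
    by (intro that[of "(sinh B * co, sinh B * si, cosh B)" "(0, 0, 1)" "(sinh A, 0, cosh A)"])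
       (simp_all add: model_carrier_def)
qed

text \<open>The identity says that D is the model distance: along a model segment h the function y t = md(p', h t) - md t solves y'' = k^2 y, so it is interpolated by sn.\<close>

lemma triangle_comparison_vertex:
  fixes p q r :: "'a::metric_space"
  assumes "\<kappa> \<le> 0" and k: "k = sqrt (- \<kappa>)"
    and geo: "geodesic_space (UNIV :: 'a set) dist"
    and tc: "triangle_comparison (UNIV :: 'a set) dist \<kappa> R"
    and g: "geodesic_path UNIV dist g q r" and t: "t \<in> {0..dist q r}"
    and ne: "p \<noteq> q" "p \<noteq> r" "q \<noteq> r"
  obtains D where "0 \<le> D" "R (dist p (g t)) D"
    "sn k (dist q r) * (md k D - md k t)
      = sn k (dist q r - t) * md k (dist p q) + sn k t * (md k (dist p r) - md k (dist q r))"
proof -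
  obtain g1 g3 where g13: "geodesic_path UNIV dist g1 p q" "geodesic_path UNIV dist g3 r p"
    using geo by (auto simp: geodesic_space_def) blast
  obtain p' q' r' where c: "p' \<in> model_carrier \<kappa>" "q' \<in> model_carrier \<kappa>" "r' \<in> model_carrier \<kappa>"
    and d: "model_dist \<kappa> p' q' = dist p q" "model_dist \<kappa> q' r' = dist q r" "model_dist \<kappa> r' p' = dist r p"
    using model_triangle_exists[OF assms(1), of "dist q r" "dist p q" "dist r p"] ne
      dist_triangle[of q r p] dist_triangle[of p q r] dist_triangle[of r p q]
    by (smt (verit) dist_commute zero_less_dist_iff)
  have seg: "geodesic_path (model_carrier \<kappa>) (model_dist \<kappa>) (model_segment k (model_dist \<kappa> u v) u v) u v"
    if "u \<in> model_carrier \<kappa>" "v \<in> model_carrier \<kappa>" "0 < model_dist \<kappa> u v" for u v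
    using model_segment_hyp(1)[of \<kappa> u v] model_segment_euc(1)[of u v] assms(1) that k
    by (cases "\<kappa> = 0") auto
  let ?h = "model_segment k (dist q r) q' r'"
  have h: "geodesic_path (model_carrier \<kappa>) (model_dist \<kappa>) ?h q' r'"
    using seg[of q' r'] c d ne by simp
  have h1: "geodesic_path (model_carrier \<kappa>) (model_dist \<kappa>) (model_segment k (dist p q) p' q') p' q'"
    using seg[of p' q'] c d ne by simp
  have h3: "geodesic_path (model_carrier \<kappa>) (model_dist \<kappa>) (model_segment k (dist r p) r' p') r' p'"
    using seg[of r' p'] c d ne by simp
  \<comment> \<open>The vertex p enters as the point with parameter 0 on the side from p to q, so
    only the comparison of a vertex with a point of the opposite side is extracted.\<close>
  have "R (dist (g1 0) (g t)) (model_dist \<kappa> (model_segment k (dist p q) p' q' 0) (?h t))"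
    using tc unfolding triangle_comparison_def
    apply -
    apply (drule bspec[where x = p], rule UNIV_I)
    apply (drule bspec[where x = q], rule UNIV_I)
    apply (drule bspec[where x = r], rule UNIV_I)
    apply (drule spec[where x = g1], drule spec[where x = g], drule spec[where x = g3], drule mp)
     apply (intro conjI g g13)
    apply (drule spec[where x = p'], drule spec[where x = q'], drule spec[where x = r'])
    apply (drule spec[where x = "model_segment k (dist p q) p' q'"], drule spec[where x = ?h],
        drule spec[where x = "model_segment k (dist r p) r' p'"], drule mp)
     apply (intro conjI c d h h1 h3)
    apply (drule bspec[where x = "(g1, model_segment k (dist p q) p' q', dist p q)"], simp)
    apply (simp only: prod.case)
    apply (drule bspec[where x = "(g, ?h, dist q r)"], simp)
    apply (simp only: prod.case)
    apply (drule bspec[where x = 0], simp)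
    apply (drule bspec[where x = t])
     apply (rule t)
    apply assumption
    done
  hence R: "R (dist p (g t)) (model_dist \<kappa> p' (?h t))"
    using g13(1) h1 by (simp add: geodesic_path_def)
  have rp: "model_dist \<kappa> p' r' = dist p r" using d(3)
    by (auto simp: model_dist_def dist_commute power2_commute mult.commute split: prod.splits if_splits)
  show ?thesis
  proof (rule that[OF _ R])
    show "0 \<le> model_dist \<kappa> p' (?h t)"
      using model_segment_hyp(3)[of \<kappa> q' r' "dist q r" k p' t] model_segment_euc(3) assms(1) k c d t ne
      by (cases "\<kappa> = 0") auto
    show "sn k (dist q r) * (md k (model_dist \<kappa> p' (?h t)) - md k t)
      = sn k (dist q r - t) * md k (dist p q) + sn k t * (md k (dist p r) - md k (dist q r))"
      using model_segment_hyp(2)[of \<kappa> q' r' "dist q r" k p' t]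
        model_segment_euc(2)[of q' r' "dist q r" p' t] assms(1) k c d t ne rp
      by (cases "\<kappa> = 0") auto
  qed
qed

section \<open>One-sided comparison inequalities along a geodesic\<close>

lemma geodesic_pathD:
  assumes "geodesic_path UNIV dist g x y"
  shows "g 0 = x" "g (dist x y) = y"
    and "s \<in> {0..dist x y} \<Longrightarrow> t \<in> {0..dist x y} \<Longrightarrow> dist (g s) (g t) = \<bar>s - t\<bar>"
    and "t \<in> {0..dist x y} \<Longrightarrow> dist x (g t) = t"
    and "t \<in> {0..dist x y} \<Longrightarrow> dist (g t) y = dist x y - t"
proof -
  show g: "g 0 = x" "g (dist x y) = y"
    "s \<in> {0..dist x y} \<Longrightarrow> t \<in> {0..dist x y} \<Longrightarrow> dist (g s) (g t) = \<bar>s - t\<bar>" for s t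
    using assms by (auto simp: geodesic_path_def)
  show "t \<in> {0..dist x y} \<Longrightarrow> dist x (g t) = t" using g(3)[of 0 t] g(1) by auto
  show "t \<in> {0..dist x y} \<Longrightarrow> dist (g t) y = dist x y - t" using g(3)[of t "dist x y"] g(2) by auto
qed

text \<open>Triangles with coinciding vertices are kept away from the model, where segments are
  divided by \<open>sn k l\<close>. The comparison is then an equality in any metric space; for
  \<open>p = r\<close> it is the second identity of \<open>sn_md_interpolate\<close>.\<close>

lemma geodesic_comparison_degenerate:
  fixes p q r :: "'a::metric_space"
  assumes g: "geodesic_path UNIV dist g q r" and t: "t \<in> {0..dist q r}"
    and eq: "p = q \<or> p = r \<or> q = r"
  shows "sn k (dist q r) * (md k (dist p (g t)) - md k t)
      = sn k (dist q r - t) * md k (dist p q) + sn k t * (md k (dist p r) - md k (dist q r))"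
proof (cases "q = r")
  case True thus ?thesis using t by simp
next
  case False
  note G = geodesic_pathD[OF g]
  consider "p = q" | "p = r" using eq False by auto
  thus ?thesis
  proof cases
    case 1 thus ?thesis using G(4)[OF t] by simp
  next
    case 2
    define l where "l = dist q r"
    have "md k (l - t) = md k (dist p (g t))" using G(5)[OF t] 2 by (simp add: l_def dist_commute)
    hence "sn k l * (md k (dist p (g t)) - md k t) = sn k (l - t) * md k l + sn k t * (0 - md k l)"
      using sn_md_interpolate(2)[of k l t] by (simp add: algebra_simps)
    thus ?thesis using 2 by (simp add: l_def dist_commute)
  qed
qed

text \<open>The comparison freed of model triangles: \<open>md k (dist p (g t)) - md k t\<close>
  lies below the \<open>sn\<close> interpolation of its end values. It is affine in the
  \<open>md\<close> values at the vertices, hence stable under weighted sums over p and easy to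
  differentiate in t.\<close>

lemma CAT_comparison:
  fixes p q r :: "'a::metric_space"
  assumes "\<kappa> \<le> 0" "k = sqrt (- \<kappa>)" "CAT \<kappa> TYPE('a)"
    and g: "geodesic_path UNIV dist g q r" and t: "t \<in> {0..dist q r}"
  shows "sn k (dist q r) * (md k (dist p (g t)) - md k t)
      \<le> sn k (dist q r - t) * md k (dist p q) + sn k t * (md k (dist p r) - md k (dist q r))"
proof (cases "p = q \<or> p = r \<or> q = r")
  case False
  then obtain D where D: "0 \<le> D" "dist p (g t) \<le> D"
    "sn k (dist q r) * (md k D - md k t)
      = sn k (dist q r - t) * md k (dist p q) + sn k t * (md k (dist p r) - md k (dist q r))"
    using assms triangle_comparison_vertex[of \<kappa> k "(\<le>)" g q r t p] by (auto simp: CAT_def)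
  have "md k (dist p (g t)) \<le> md k D" using D by (intro md_mono) auto
  thus ?thesis using D(3) sn_nonneg[of "dist q r" k]
    by (metis diff_right_mono mult_left_mono zero_le_dist)
qed (use geodesic_comparison_degenerate[OF g t] in auto)

lemma CBB_comparison:
  fixes p q r :: "'a::metric_space"
  assumes "\<kappa> \<le> 0" "k = sqrt (- \<kappa>)" "CBB \<kappa> TYPE('a)"
    and g: "geodesic_path UNIV dist g q r" and t: "t \<in> {0..dist q r}"
  shows "sn k (dist q r) * (md k (dist p (g t)) - md k t)
      \<ge> sn k (dist q r - t) * md k (dist p q) + sn k t * (md k (dist p r) - md k (dist q r))"
proof (cases "p = q \<or> p = r \<or> q = r")
  case False
  then obtain D where D: "0 \<le> D" "dist p (g t) \<ge> D"
    "sn k (dist q r) * (md k D - md k t)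
      = sn k (dist q r - t) * md k (dist p q) + sn k t * (md k (dist p r) - md k (dist q r))"
    using assms triangle_comparison_vertex[of \<kappa> k "(\<lambda>a b. b \<le> a)" g q r t p] by (auto simp: CBB_def)
  have "md k D \<le> md k (dist p (g t))" using D by (intro md_mono) auto
  thus ?thesis using D(3) sn_nonneg[of "dist q r" k]
    by (metis diff_right_mono mult_left_mono zero_le_dist)
qed (use geodesic_comparison_degenerate[OF g t] in auto)

section \<open>Intersections of balls in CAT spaces\<close>

text \<open>Fermat's condition at a left endpoint. Geodesics issue from the extremal point in one
  direction only, so just the sign of the derivative is available.\<close>

lemma DERIV_right_minimum:
  fixes T :: "real \<Rightarrow> real"
  assumes "(T has_real_derivative D) (at 0)" "0 < l" "\<And>s. s \<in> {0..l} \<Longrightarrow> T 0 \<le> T s"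
  shows "0 \<le> D"
proof (rule ccontr)
  assume "\<not> 0 \<le> D"
  then obtain d where d: "d > 0" "\<And>h. h > 0 \<Longrightarrow> h < d \<Longrightarrow> T 0 > T (0 + h)"
    using DERIV_neg_dec_right[OF assms(1)] by (metis not_le)
  define h where "h = min (d / 2) l"
  have "h > 0" "h < d" "h \<le> l" using d(1) assms(2) by (auto simp: h_def)
  thus False using d(2)[of h] assms(3)[of h] by auto
qed

text \<open>For k = 0 this is the CN inequality of Bruhat and Tits; in general the same inequality
  is demanded for \<open>md k\<close>.\<close>

definition strong_midpoint :: "real \<Rightarrow> 'a::metric_space \<Rightarrow> 'a \<Rightarrow> 'a \<Rightarrow> bool" where
  "strong_midpoint k a b m \<longleftrightarrow>
     (\<forall>p. md k (dist p m) + md k (dist a b / 2) \<le> (md k (dist p a) + md k (dist p b)) / 2)"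

text \<open>A weak form of convexity that passes to intersections and holds for sublevel sets.
  Quantifying over every strong midpoint avoids any appeal to uniqueness.\<close>

definition midconvex :: "real \<Rightarrow> 'a::metric_space set \<Rightarrow> bool" where
  "midconvex k C \<longleftrightarrow> (\<forall>a\<in>C. \<forall>b\<in>C. \<forall>m. strong_midpoint k a b m \<longrightarrow> m \<in> C)"

lemma midconvex_Inter: "(\<And>C. C \<in> F \<Longrightarrow> midconvex k C) \<Longrightarrow> midconvex k (\<Inter>F)"
  unfolding midconvex_def by blast

lemma midconvex_sublevel:
  fixes h :: "'a::metric_space \<Rightarrow> real"
  assumes "\<And>a b m. strong_midpoint k a b m \<Longrightarrow> h m \<le> (h a + h b) / 2"
  shows "midconvex k {z. h z \<le> c}"
  unfolding midconvex_def using assms by fastforce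

lemma strong_midpoint_md:
  "strong_midpoint k a b m \<Longrightarrow> md k (dist p m) \<le> (md k (dist p a) + md k (dist p b)) / 2"
  unfolding strong_midpoint_def using md_nonneg[of k "dist a b / 2"] by (smt (verit))

text \<open>At the middle of a geodesic the double argument formulas let \<open>sn k (l/2)\<close>
  cancel, leaving c X + n \<le> (P + Q) / 2 with c a value of cosh; since c \<ge> 1, it may be
  dropped.\<close>

lemma CAT_strong_midpoint:
  fixes a b :: "'b::metric_space"
  assumes "\<kappa> \<le> 0" "k = sqrt (- \<kappa>)" "CAT \<kappa> TYPE('b)"
  obtains m where "strong_midpoint k a b m"
proof (cases "a = b")
  case True
  thus ?thesis by (intro that[of a]) (simp add: strong_midpoint_def)
next
  case False
  define l where "l = dist a b"
  have l: "l > 0" using False by (simp add: l_def)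
  obtain g where g: "geodesic_path UNIV dist g a b"
    using assms by (auto simp: CAT_def geodesic_space_def)
  show ?thesis
  proof (rule that[of "g (l/2)"], unfold strong_midpoint_def, rule allI)
    fix p
    define X P Q s c n where "X = md k (dist p (g (l/2)))" "P = md k (dist p a)" "Q = md k (dist p b)"
      "s = sn k (l/2)" "c = cosh (k * (l/2))" "n = md k (l/2)"
    note defs = this
    have "sn k l * (X - n) \<le> s * P + s * (Q - md k l)"
      using CAT_comparison[OF assms g, of "l/2" p] l by (simp add: defs l_def)
    moreover have "sn k l = 2 * s * c" "md k l = 2 * n * (1 + c)"
      using sn_double[of k "l/2"] md_double[of k "l/2"] by (simp_all add: defs)
    ultimately have "s * (2 * c * (X - n)) \<le> s * (P + (Q - 2 * n * (1 + c)))"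
      by (simp add: algebra_simps)
    hence "2 * c * (X - n) \<le> P + (Q - 2 * n * (1 + c))"
      using sn_pos[of "l/2" k] l by (simp add: defs(4))
    moreover have "X \<le> c * X" using mult_right_mono[OF cosh_real_ge_1[of "k * (l/2)"], of X] by (simp add: defs)
    ultimately have "X + n \<le> (P + Q) / 2" by (simp add: algebra_simps)
    thus "md k (dist p (g (l/2))) + md k (dist a b / 2) \<le> (md k (dist p a) + md k (dist p b)) / 2"
      by (simp add: defs l_def)
  qed
qed

text \<open>A substitute for weak compactness of bounded closed convex sets. Points of C that are
  nearly closest to \<open>y0\<close> form a set of small diameter once C is far down in the family,
  because the midpoint of two such points would otherwise be too close to \<open>y0\<close>.
  Completeness then yields a common limit.\<close>

lemma midconvex_directed_Inter:
  fixes F :: "'b::complete_space set set"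
  assumes mid: "\<And>a b::'b. \<exists>m. strong_midpoint k a b m"
    and "F \<noteq> {}" and cl: "\<And>C. C \<in> F \<Longrightarrow> closed C" and cv: "\<And>C. C \<in> F \<Longrightarrow> midconvex k C"
    and dir: "\<And>C D. C \<in> F \<Longrightarrow> D \<in> F \<Longrightarrow> \<exists>E\<in>F. E \<subseteq> C \<inter> D"
    and bd: "\<And>C. C \<in> F \<Longrightarrow> \<exists>x\<in>C. dist y0 x \<le> R"
  shows "\<Inter>F \<noteq> {}"
proof -
  define \<delta> where "\<delta> C = (INF x\<in>C. md k (dist y0 x))" for C
  have bdd: "bdd_below ((\<lambda>x. md k (dist y0 x)) ` C)" for C by (auto intro!: bdd_belowI[of _ 0])
  have ne: "C \<noteq> {}" if C: "C \<in> F" for C using bd[OF C] by auto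
  have \<delta>R: "\<delta> C \<le> md k R" if C: "C \<in> F" for C
  proof -
    obtain x where x: "x \<in> C" "dist y0 x \<le> R" using bd[OF C] by auto
    have "\<delta> C \<le> md k (dist y0 x)" unfolding \<delta>_def by (rule cINF_lower[OF bdd x(1)])
    also have "\<dots> \<le> md k R" using x by (intro md_mono) auto
    finally show ?thesis .
  qed
  define S where "S = (SUP C\<in>F. \<delta> C)"
  have bddS: "bdd_above (\<delta> ` F)" using \<delta>R by (auto intro!: bdd_aboveI)
  have \<delta>S: "\<delta> C \<le> S" if "C \<in> F" for C unfolding S_def by (rule cSUP_upper[OF that bddS])
  define N where "N C e = {x \<in> C. md k (dist y0 x) \<le> S + e}" for C e
  have Nne: "\<exists>x. x \<in> N C e" if C: "C \<in> F" and e: "e > 0" for C e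
  proof -
    have "\<delta> C < S + e" using \<delta>S[OF C] e by simp
    then obtain x where "x \<in> C" "md k (dist y0 x) < S + e"
      using cINF_less_iff[OF ne[OF C] bdd] unfolding \<delta>_def by auto
    thus ?thesis unfolding N_def by auto
  qed
  \<comment> \<open>The midpoint lies in C, so its \<open>md\<close> to \<open>y0\<close> is at
    least S - e, while the average over the two points is at most S + e. Thus \<open>md\<close> of
    half the distance is at most 2e, and \<open>md_ge\<close> turns this into the factor 4.\<close>
  have diam: "dist x x' \<le> 4 * sqrt e" if "C \<in> F" "S - e \<le> \<delta> C" "x \<in> N C e" "x' \<in> N C e" "e > 0" for C e x x'
  proof -
    obtain m where m: "strong_midpoint k x x' m" using mid by blast
    have "m \<in> C" using cv[OF that(1)] m that(3,4) unfolding midconvex_def N_def by blast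
    hence "\<delta> C \<le> md k (dist y0 m)" unfolding \<delta>_def by (rule cINF_lower[OF bdd])
    moreover have "md k (dist y0 m) + md k (dist x x' / 2) \<le> (md k (dist y0 x) + md k (dist y0 x')) / 2"
      using m by (simp add: strong_midpoint_def)
    ultimately have "md k (dist x x' / 2) \<le> 2 * e" using that unfolding N_def by auto
    hence "(dist x x')\<^sup>2 \<le> (4 * sqrt e)\<^sup>2"
      using md_ge[of "dist x x' / 2" k] that(5) by (simp add: power_mult_distrib power_divide)
    thus ?thesis by (rule power2_le_imp_le) (use that in auto)
  qed
  define r where "r n = 1 / real (Suc n)" for n
  have r: "r n > 0" for n by (simp add: r_def)
  have Ex: "\<exists>C\<in>F. S - r n \<le> \<delta> C" for n
  proof -
    have "S - r n < S" using r[of n] by simp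
    then obtain C where "C \<in> F" "S - r n < \<delta> C"
      unfolding S_def using less_cSUP_iff[OF \<open>F \<noteq> {}\<close> bddS] by auto
    thus ?thesis by force
  qed
  have mono\<delta>: "\<delta> C \<le> \<delta> D" if "D \<subseteq> C" "D \<in> F" for C D
    unfolding \<delta>_def using that ne[OF that(2)] by (intro cINF_superset_mono bdd) auto
  \<comment> \<open>Directedness permits a decreasing sequence along which \<delta> tends to S; all
    later points then lie in the same sets of small diameter.\<close>
  have "\<exists>D. \<forall>n. (D n \<in> F \<and> S - r n \<le> \<delta> (D n)) \<and> D (Suc n) \<subseteq> D n"
  proof (rule dependent_nat_choice)
    show "\<exists>x. x \<in> F \<and> S - r 0 \<le> \<delta> x" using Ex by blast
  next
    fix C n assume C: "C \<in> F \<and> S - r n \<le> \<delta> C"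
    obtain D where D: "D \<in> F" "S - r (Suc n) \<le> \<delta> D" using Ex by blast
    obtain E where E: "E \<in> F" "E \<subseteq> C \<inter> D" using dir C D by meson
    thus "\<exists>y. (y \<in> F \<and> S - r (Suc n) \<le> \<delta> y) \<and> y \<subseteq> C"
      using D mono\<delta>[of E D] by (intro exI[of _ E]) auto
  qed
  then obtain D where D: "\<And>n. D n \<in> F" "\<And>n. S - r n \<le> \<delta> (D n)" "\<And>n. D (Suc n) \<subseteq> D n" by auto
  have dec: "D m \<subseteq> D n" if "n \<le> m" for n m
    using that D(3) by (rule lift_Suc_antimono_le[of D, rotated])
  have rdec: "r m \<le> r n" if "n \<le> m" for n m using that by (simp add: r_def frac_le)
  have "\<forall>n. \<exists>x. x \<in> N (D n) (r n)" using Nne[OF D(1) r] by blast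
  then obtain x where x: "\<And>n. x n \<in> N (D n) (r n)" by metis
  have xin: "x m \<in> N (D n) (r n)" if "n \<le> m" for n m
    using x[of m] dec[OF that] rdec[OF that] unfolding N_def by auto
  have lim0: "(\<lambda>n. 4 * sqrt (r n)) \<longlonglongrightarrow> 0"
    unfolding r_def using tendsto_mult_right_zero[OF tendsto_real_sqrt[OF LIMSEQ_inverse_real_of_nat, unfolded real_sqrt_zero]]
    by (simp add: inverse_eq_divide)
  have "Cauchy x"
  proof (rule metric_CauchyI)
    fix e :: real assume "e > 0"
    then obtain n where n: "4 * sqrt (r n) < e"
      using order_tendstoD(2)[OF lim0] by (auto simp: eventually_sequentially)
    have "dist (x i) (x j) < e" if "i \<ge> n" "j \<ge> n" for i j
      using diam[OF D(1,2) xin[OF that(1)] xin[OF that(2)] r] n by simp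
    thus "\<exists>M. \<forall>m\<ge>M. \<forall>n\<ge>M. dist (x m) (x n) < e" by blast
  qed
  then obtain q where q: "x \<longlonglongrightarrow> q" using Cauchy_convergent convergent_def by blast
  have "q \<in> C" if C: "C \<in> F" for C
  proof -
    \<comment> \<open>A member E inside both C and \<open>D n\<close> has a near-minimiser z. It
      belongs to C and, as a point of \<open>N (D n) (r n)\<close>, is close to \<open>x n\<close>;
      so q is also a limit of points of C.\<close>
    have "\<forall>n. \<exists>z. z \<in> C \<and> dist (x n) z \<le> 4 * sqrt (r n)"
    proof
      fix n
      obtain E where E: "E \<in> F" "E \<subseteq> C \<inter> D n" using dir[OF C D(1)] by blast
      obtain z where z: "z \<in> N E (r n)" using Nne[OF E(1) r] by blast
      hence "z \<in> N (D n) (r n)" "z \<in> C" using E unfolding N_def by auto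
      thus "\<exists>z. z \<in> C \<and> dist (x n) z \<le> 4 * sqrt (r n)"
        using diam[OF D(1,2) x _ r] by blast
    qed
    then obtain z where z: "\<And>n. z n \<in> C" "\<And>n. dist (x n) (z n) \<le> 4 * sqrt (r n)" by metis
    have "(\<lambda>n. dist (x n) (z n)) \<longlonglongrightarrow> 0"
      by (rule tendsto_sandwich[OF _ _ tendsto_const lim0]) (use z in auto)
    hence "(\<lambda>n. dist (x n) (z n) + dist (x n) q) \<longlonglongrightarrow> 0"
      using q by (auto intro!: tendsto_add_zero simp: tendsto_dist_iff[symmetric])
    hence "(\<lambda>n. dist (z n) q) \<longlonglongrightarrow> 0"
      by (rule tendsto_sandwich[OF _ _ tendsto_const, rotated -1])
         (auto intro!: always_eventually dist_triangle3)
    hence "z \<longlonglongrightarrow> q" by (rule iffD2[OF tendsto_dist_iff])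
    thus ?thesis using closed_sequentially[OF cl[OF C]] z(1) by blast
  qed
  thus ?thesis by blast
qed

text \<open>Minimise the sum of the squared excesses max 0 (md(z, y_i) - c_i). At a minimiser q with nonzero excess, the first-order condition says that q is the barycentre of the y_i weighted by the excesses, which makes the weighted excess nonpositive.\<close>

lemma CAT_finite_ball_intersection:
  fixes y :: "'i \<Rightarrow> 'b::complete_space" and c :: "'i \<Rightarrow> real" and W :: "'i \<Rightarrow> 'i \<Rightarrow> real"
  assumes cat: "\<kappa> \<le> 0" "k = sqrt (- \<kappa>)" "CAT \<kappa> TYPE('b)"
    and fin: "finite I" and c0: "\<And>i. i \<in> I \<Longrightarrow> 0 \<le> c i"
    and W: "\<And>i j. i \<in> I \<Longrightarrow> j \<in> I \<Longrightarrow> md k (dist (y i) (y j)) \<le> W i j"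
    and LSS: "\<And>w. (\<And>i. i \<in> I \<Longrightarrow> 0 \<le> w i) \<Longrightarrow> (\<Sum>i\<in>I. w i) = 1 \<Longrightarrow>
      (\<Sum>i\<in>I. \<Sum>j\<in>I. w i * w j * W i j) \<le> 2 * (\<Sum>i\<in>I. w i * c i) + k\<^sup>2 * (\<Sum>i\<in>I. w i * c i)\<^sup>2"
  shows "\<exists>q. \<forall>i\<in>I. md k (dist q (y i)) \<le> c i"
proof (cases "I = {}")
  case False
  define \<Psi> where "\<Psi> z = (\<Sum>i\<in>I. (max 0 (md k (dist z (y i)) - c i))\<^sup>2)" for z
  have mid: "\<exists>m. strong_midpoint k a b m" for a b :: 'b
    using CAT_strong_midpoint[OF cat] by metis
  have \<Psi>0: "0 \<le> \<Psi> z" for z unfolding \<Psi>_def by (intro sum_nonneg) auto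
  have \<Psi>cont: "continuous_on UNIV \<Psi>" unfolding \<Psi>_def by (intro continuous_intros)
  have \<Psi>conv: "\<Psi> m \<le> (\<Psi> a + \<Psi> b) / 2" if m: "strong_midpoint k a b m" for a b m
  proof -
    have "(max 0 (md k (dist m (y i)) - c i))\<^sup>2 \<le>
      ((max 0 (md k (dist a (y i)) - c i))\<^sup>2 + (max 0 (md k (dist b (y i)) - c i))\<^sup>2) / 2" for i
    proof -
      define u v where "u = max 0 (md k (dist a (y i)) - c i)" "v = max 0 (md k (dist b (y i)) - c i)"
      have "max 0 (md k (dist m (y i)) - c i) \<le> (u + v) / 2"
        using strong_midpoint_md[OF m, of "y i"] unfolding u_v_def max_def by (auto simp: dist_commute)
      hence "(max 0 (md k (dist m (y i)) - c i))\<^sup>2 \<le> ((u + v) / 2)\<^sup>2" by (rule power_mono) simp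
      also have "\<dots> \<le> (u\<^sup>2 + v\<^sup>2) / 2"
        using sum_squares_bound[of u v] by (simp add: power2_eq_square field_simps)
      finally show ?thesis by (simp add: u_v_def)
    qed
    hence "\<Psi> m \<le> (\<Sum>i\<in>I. ((max 0 (md k (dist a (y i)) - c i))\<^sup>2 + (max 0 (md k (dist b (y i)) - c i))\<^sup>2) / 2)"
      unfolding \<Psi>_def by (rule sum_mono)
    thus ?thesis by (simp add: \<Psi>_def sum.distrib sum_divide_distrib add_divide_distrib)
  qed
  obtain i0 where i0: "i0 \<in> I" using False by blast
  define m0 where "m0 = (INF z. \<Psi> z)"
  have bdd: "bdd_below (range \<Psi>)" using \<Psi>0 by (auto intro!: bdd_belowI)
  \<comment> \<open>The infimum of \<Psi> is attained at a common point of the sublevel sets just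
    above it. The cap \<open>m0 + 1\<close> keeps a point of each of them within a fixed distance of
    \<open>y i0\<close>.\<close>
  define F where "F = (\<lambda>e. {z. \<Psi> z \<le> e}) ` {m0<..m0 + 1}"
  have "\<Inter>F \<noteq> {}"
  proof (rule midconvex_directed_Inter[OF mid])
    show "F \<noteq> {}" by (simp add: F_def)
    show "closed C" if "C \<in> F" for C
      using that continuous_closed_vimage[of _ \<Psi>] \<Psi>cont
      by (auto simp: F_def intro!: closed_Collect_le continuous_intros)
    show "midconvex k C" if "C \<in> F" for C
      using that by (auto simp: F_def intro!: midconvex_sublevel \<Psi>conv)
    show "\<exists>E\<in>F. E \<subseteq> C \<inter> D" if "C \<in> F" "D \<in> F" for C D
    proof -
      obtain e e' where "e \<in> {m0<..m0+1}" "C = {z. \<Psi> z \<le> e}" "e' \<in> {m0<..m0+1}" "D = {z. \<Psi> z \<le> e'}"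
        using \<open>C \<in> F\<close> \<open>D \<in> F\<close> by (auto simp: F_def)
      thus ?thesis by (intro bexI[of _ "{z. \<Psi> z \<le> min e e'}"]) (auto simp: F_def min_def)
    qed
    show "\<exists>x\<in>C. dist (y i0) x \<le> sqrt (2 * (c i0 + (m0 + 2)))" if C: "C \<in> F" for C
    proof -
      obtain e where e: "C = {z. \<Psi> z \<le> e}" "m0 < e" "e \<le> m0 + 1" using C by (auto simp: F_def)
      obtain z where z: "\<Psi> z < e" using e(2) unfolding m0_def by (auto simp: cINF_less_iff[OF _ bdd])
      have "(max 0 (md k (dist z (y i0)) - c i0))\<^sup>2 \<le> \<Psi> z"
        unfolding \<Psi>_def by (rule member_le_sum[OF i0]) (use fin in auto)
      hence "(max 0 (md k (dist z (y i0)) - c i0))\<^sup>2 \<le> m0 + 1" using z e by simp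
      moreover have "x \<le> x\<^sup>2 + 1" for x :: real
        using sum_squares_bound[of x "1/2"] zero_le_power2[of x] by (simp add: power2_eq_square)
      ultimately have "md k (dist z (y i0)) - c i0 \<le> m0 + 2" by (smt (verit))
      hence "(dist (y i0) z)\<^sup>2 \<le> 2 * (c i0 + (m0 + 2))"
        using md_ge[of "dist z (y i0)" k] by (simp add: dist_commute)
      hence "dist (y i0) z \<le> sqrt (2 * (c i0 + (m0 + 2)))" by (rule real_le_rsqrt)
      thus ?thesis using z e by (intro bexI[of _ z]) auto
    qed
  qed
  then obtain q where "q \<in> \<Inter>F" by blast
  hence q: "\<Psi> q \<le> e" if "m0 < e" "e \<le> m0 + 1" for e using that by (auto simp: F_def)
  have "\<Psi> q \<le> m0"
  proof (rule dense_ge)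
    fix e assume "m0 < e"
    thus "\<Psi> q \<le> e" using q[of "min e (m0 + 1)"] by auto
  qed
  moreover have "m0 \<le> \<Psi> z" for z unfolding m0_def by (rule cINF_lower[OF bdd]) simp
  ultimately have qmin: "\<Psi> q \<le> \<Psi> z" for z by (meson order_trans)
  define v where "v i = max 0 (md k (dist q (y i)) - c i)" for i
  have v0: "0 \<le> v i" for i by (simp add: v_def)
  have \<Psi>q: "\<Psi> q = (\<Sum>i\<in>I. (v i)\<^sup>2)" by (simp add: \<Psi>_def v_def)
  have first: "0 \<le> (\<Sum>i\<in>I. v i * (md k (dist z (y i)) - md k (dist q z) - cosh (k * dist q z) * md k (dist q (y i))))"
    for z
  proof (cases "z = q")
    case True thus ?thesis by simp
  next
    case False
    define l where "l = dist q z"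
    have l: "l > 0" using False by (simp add: l_def)
    obtain g where g: "geodesic_path UNIV dist g q z"
      using cat by (auto simp: CAT_def geodesic_space_def)
    \<comment> \<open>The upper bound for \<open>md k (dist (g s) (y i))\<close> given by the CAT
      comparison, with equality at s = 0. It is differentiable, which the distance itself need not
      be.\<close>
    define U where "U i s = md k s + (sn k (l - s) * md k (dist q (y i)) + sn k s * (md k (dist z (y i)) - md k l)) / sn k l"
      for i s
    define U' where "U' i = (md k (dist z (y i)) - md k l - cosh (k * l) * md k (dist q (y i))) / sn k l" for i
    have sl: "sn k l > 0" using sn_pos l by simp
    have U0: "U i 0 = md k (dist q (y i))" for i using sl by (simp add: U_def)
    have dU: "(U i has_real_derivative U' i) (at 0)" for i
      unfolding U_def U'_def using sl
      by (auto intro!: derivative_eq_intros simp: field_simps)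
    have Uge: "md k (dist (g s) (y i)) \<le> U i s" if "s \<in> {0..l}" for i s
      using CAT_comparison[OF cat g, of s "y i"] that sl
      by (simp add: U_def l_def dist_commute field_simps)
    \<comment> \<open>A differentiable majorant of \<open>\<Psi> (g s) - \<Psi> q\<close> that
      vanishes at s = 0, so minimality of q forces a nonnegative derivative there. It relies on (max
      0 x)^2 \<le> (max 0 x0 + (x - x0))^2.\<close>
    define T where "T s = (\<Sum>i\<in>I. 2 * v i * (U i s - U i 0) + (U i s - U i 0)\<^sup>2)" for s
    have T: "T 0 \<le> T s" if s: "s \<in> {0..l}" for s
    proof -
      have "(max 0 (md k (dist (g s) (y i)) - c i))\<^sup>2 \<le> (v i)\<^sup>2 + (2 * v i * (U i s - U i 0) + (U i s - U i 0)\<^sup>2)" for i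
      proof -
        have "(max 0 (md k (dist (g s) (y i)) - c i))\<^sup>2 \<le> (max 0 (U i s - c i))\<^sup>2"
          using Uge[OF s, of i] by (intro power_mono) auto
        also have "\<dots> \<le> (v i + (U i s - U i 0))\<^sup>2"
          unfolding v_def U0[symmetric]
        proof -
          define x x0 where "x = U i s - c i" "x0 = U i 0 - c i"
          have "(max 0 x)\<^sup>2 \<le> (max 0 x0 + (x - x0))\<^sup>2"
          proof (cases "x \<le> 0")
            case False
            hence "0 \<le> x" "x \<le> max 0 x0 + (x - x0)" by auto
            thus ?thesis by (intro power_mono) auto
          qed simp
          thus "(max 0 (U i s - c i))\<^sup>2 \<le> (max 0 (U i 0 - c i) + (U i s - U i 0))\<^sup>2"
            by (simp add: x_x0_def)
        qed
        finally show ?thesis by (simp add: power2_eq_square algebra_simps)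
      qed
      hence "\<Psi> (g s) \<le> (\<Sum>i\<in>I. (v i)\<^sup>2 + (2 * v i * (U i s - U i 0) + (U i s - U i 0)\<^sup>2))"
        unfolding \<Psi>_def by (rule sum_mono)
      hence "0 \<le> T s" using qmin[of "g s"] by (simp add: \<Psi>q sum.distrib T_def)
      thus ?thesis by (simp add: T_def)
    qed
    have dT: "(T has_real_derivative (\<Sum>i\<in>I. 2 * v i * U' i)) (at 0)"
      unfolding T_def using dU by (auto intro!: derivative_eq_intros sum.cong)
    have "0 \<le> (\<Sum>i\<in>I. 2 * v i * U' i)"
      by (rule DERIV_right_minimum[OF dT l T])
    also have "(\<Sum>i\<in>I. 2 * v i * U' i) = 2 / sn k l * (\<Sum>i\<in>I. v i * (md k (dist z (y i)) - md k l - cosh (k * l) * md k (dist q (y i))))"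
      by (simp add: U'_def sum_distrib_left mult_ac)
    finally show ?thesis using sl by (simp add: l_def zero_le_mult_iff zero_le_divide_iff)
  qed
  have "\<Psi> q = 0"
  proof (rule ccontr)
    assume "\<Psi> q \<noteq> 0"
    hence \<Psi>pos: "\<Psi> q > 0" using \<Psi>0[of q] by simp
    define V where "V = (\<Sum>i\<in>I. v i)"
    have "V > 0"
    proof (rule ccontr)
      assume "\<not> V > 0"
      hence "V = 0" using v0 by (simp add: V_def sum_nonneg order.antisym not_less)
      hence "\<forall>i\<in>I. v i = 0" using v0 fin by (simp add: V_def sum_nonneg_eq_0_iff)
      thus False using \<Psi>pos by (simp add: \<Psi>q)
    qed
    define w where "w i = v i / V" for i
    have w0: "0 \<le> w i" for i using v0 \<open>V > 0\<close> by (simp add: w_def)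
    have w1: "(\<Sum>i\<in>I. w i) = 1" using \<open>V > 0\<close> by (simp add: w_def V_def sum_divide_distrib[symmetric])
    define Fq Fc where "Fq = (\<Sum>i\<in>I. w i * md k (dist q (y i)))" "Fc = (\<Sum>i\<in>I. w i * c i)"
    have "w i * md k (dist q (y i)) - w i * c i = (v i)\<^sup>2 / V" for i
    proof -
      have "v i * (md k (dist q (y i)) - c i) = (v i)\<^sup>2"
        by (simp add: v_def max_def power2_eq_square)
      thus ?thesis by (simp add: w_def diff_divide_distrib[symmetric] right_diff_distrib)
    qed
    hence "Fq - Fc = (\<Sum>i\<in>I. (v i)\<^sup>2) / V"
      unfolding Fq_Fc_def sum_subtractf[symmetric] sum_divide_distrib by simp
    hence gt: "Fq > Fc" using \<Psi>pos \<open>V > 0\<close> \<Psi>q by (metis diff_gt_0_iff_gt divide_pos_pos)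
    have Fc0: "0 \<le> Fc" unfolding Fq_Fc_def using w0 c0 by (intro sum_nonneg mult_nonneg_nonneg) auto
    have F: "(\<Sum>i\<in>I. w i * md k (dist z (y i))) \<ge> md k (dist q z) + (1 + k\<^sup>2 * md k (dist q z)) * Fq" for z
    proof -
      have "0 \<le> (\<Sum>i\<in>I. v i * (md k (dist z (y i)) - md k (dist q z) - (1 + k\<^sup>2 * md k (dist q z)) * md k (dist q (y i)))) / V"
        using first[of z] \<open>V > 0\<close> by (simp add: cosh_eq_md)
      also have "\<dots> = (\<Sum>i\<in>I. w i * md k (dist z (y i)) - w i * md k (dist q z) - (1 + k\<^sup>2 * md k (dist q z)) * (w i * md k (dist q (y i))))"
        unfolding sum_divide_distrib using \<open>V > 0\<close> by (intro sum.cong) (auto simp: w_def field_simps)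
      also have "\<dots> = (\<Sum>i\<in>I. w i * md k (dist z (y i))) - md k (dist q z) - (1 + k\<^sup>2 * md k (dist q z)) * Fq"
        by (simp add: sum_subtractf Fq_Fc_def sum_distrib_left[symmetric] sum_distrib_right[symmetric] w1)
      finally show ?thesis by simp
    qed
    \<comment> \<open>The barycentre inequality \<open>F\<close> is applied at each
      \<open>y j\<close> and averaged with the weights. The double sum that arises is controlled by
      W, which forces 2t + k^2 t^2 to be no larger at \<open>Fq\<close> than at \<open>Fc\<close>,
      against \<open>Fq > Fc\<close>.\<close>
    have "2 * Fq + k\<^sup>2 * Fq\<^sup>2 = (\<Sum>j\<in>I. w j * (md k (dist q (y j)) + (1 + k\<^sup>2 * md k (dist q (y j))) * Fq))"
    proof -
      have "(\<Sum>j\<in>I. w j * (md k (dist q (y j)) + (1 + k\<^sup>2 * md k (dist q (y j))) * Fq)) =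
        (\<Sum>j\<in>I. w j * md k (dist q (y j)) + w j * Fq + k\<^sup>2 * Fq * (w j * md k (dist q (y j))))"
        by (intro sum.cong) (auto simp: algebra_simps)
      also have "\<dots> = Fq + Fq + k\<^sup>2 * Fq * Fq"
        by (simp add: sum.distrib sum_distrib_left[symmetric] sum_distrib_right[symmetric] w1 Fq_Fc_def)
      finally show ?thesis by (simp add: power2_eq_square)
    qed
    also have "\<dots> \<le> (\<Sum>j\<in>I. w j * (\<Sum>i\<in>I. w i * md k (dist (y j) (y i))))"
      using F w0 by (intro sum_mono mult_left_mono) auto
    also have "\<dots> \<le> (\<Sum>j\<in>I. w j * (\<Sum>i\<in>I. w i * W j i))"
      using W w0 by (intro sum_mono mult_left_mono) auto
    also have "\<dots> = (\<Sum>i\<in>I. \<Sum>j\<in>I. w i * w j * W i j)"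
      by (simp add: sum_distrib_left mult_ac)
    also have "\<dots> \<le> 2 * Fc + k\<^sup>2 * Fc\<^sup>2" unfolding Fq_Fc_def by (rule LSS[OF w0 w1])
    also have "\<dots> < 2 * Fq + k\<^sup>2 * Fq\<^sup>2"
      using gt Fc0 power_mono[of Fc Fq 2] by (intro add_less_le_mono mult_left_mono) auto
    finally show False by simp
  qed
  hence "\<forall>i\<in>I. (v i)\<^sup>2 = 0" unfolding \<Psi>q using fin by (subst (asm) sum_nonneg_eq_0_iff) auto
  thus ?thesis by (intro exI[of _ q]) (auto simp: v_def max_def split: if_splits)
qed simp

section \<open>A variance inequality in CBB spaces\<close>

lemma geodesic_path_sub:
  assumes g: "geodesic_path UNIV dist g x y" and ab: "0 \<le> a" "a \<le> b" "b \<le> dist x y"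
  shows "geodesic_path UNIV dist (\<lambda>t. g (a + t)) (g a) (g b)" "dist (g a) (g b) = b - a"
proof -
  show d: "dist (g a) (g b) = b - a" using geodesic_pathD(3)[OF g, of a b] ab by auto
  show "geodesic_path UNIV dist (\<lambda>t. g (a + t)) (g a) (g b)"
    unfolding geodesic_path_def d using geodesic_pathD(3)[OF g] ab by auto
qed

text \<open>An infinitesimal gradient argument for f z = \<Sum> w_i md(z, x_i) at p. Let G be the upper slope of f at p. Moving away from p in a direction of almost maximal slope, f does not decrease, while by comparison the distances to the x_i grow at most by the directional derivatives of f towards x_i, up to the factor -1/G. Since the average of these derivatives has the sign of the left side minus the right side, that difference is nonpositive.\<close>

lemma CBB_variance_inequality:
  fixes x :: "'i \<Rightarrow> 'a::metric_space" and w :: "'i \<Rightarrow> real"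
  assumes cbb: "\<kappa> \<le> 0" "k = sqrt (- \<kappa>)" "CBB \<kappa> TYPE('a)"
    and fin: "finite I" and w0: "\<And>i. i \<in> I \<Longrightarrow> 0 \<le> w i" and w1: "(\<Sum>i\<in>I. w i) = 1"
  shows "(\<Sum>i\<in>I. \<Sum>j\<in>I. w i * w j * md k (dist (x i) (x j)))
    \<le> 2 * (\<Sum>i\<in>I. w i * md k (dist p (x i))) + k\<^sup>2 * (\<Sum>i\<in>I. w i * md k (dist p (x i)))\<^sup>2"
proof -
  define f where "f z = (\<Sum>i\<in>I. w i * md k (dist z (x i)))" for z
  define V where "V = (\<Sum>i\<in>I. \<Sum>j\<in>I. w i * w j * md k (dist (x i) (x j)))"
  \<comment> \<open>Divided by \<open>sn k (dist z (x i))\<close>, this is the lower bound that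
    comparison gives for the derivative of f at z towards \<open>x i\<close>. Its weighted mean is
    the difference of the two sides of the claim, with z for p.\<close>
  define E where "E z i = f (x i) - md k (dist z (x i)) - cosh (k * dist z (x i)) * f z" for z i
  define L where "L = (\<Sum>i\<in>I. w i * sn k (dist p (x i) + 1))"
  have f0: "0 \<le> f z" for z unfolding f_def using w0 by (intro sum_nonneg) auto
  have L0: "0 \<le> L" unfolding L_def using w0 by (intro sum_nonneg mult_nonneg_nonneg sn_nonneg) auto
  have wsum: "(\<Sum>i\<in>I. w i * c) = c" for c by (simp add: sum_distrib_right[symmetric] w1)
  \<comment> \<open>The CBB comparison is affine in the \<open>md\<close> values and the weights sum
    to 1, so f inherits it.\<close>
  have concave: "sn k (dist a b) * (f (g t) - md k t) \<ge> sn k (dist a b - t) * f a + sn k t * (f b - md k (dist a b))"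
    if g: "geodesic_path UNIV dist g a b" and t: "t \<in> {0..dist a b}" for g a b t
  proof -
    have "sn k (dist a b - t) * md k (dist a (x i)) + sn k t * (md k (dist b (x i)) - md k (dist a b))
      \<le> sn k (dist a b) * (md k (dist (g t) (x i)) - md k t)" for i
      using CBB_comparison[OF cbb g t, of "x i"] by (simp add: dist_commute)
    hence "(\<Sum>i\<in>I. w i * (sn k (dist a b - t) * md k (dist a (x i)) + sn k t * (md k (dist b (x i)) - md k (dist a b))))
      \<le> (\<Sum>i\<in>I. w i * (sn k (dist a b) * (md k (dist (g t) (x i)) - md k t)))"
      using w0 by (intro sum_mono mult_left_mono) auto
    also have "\<dots> = sn k (dist a b) * f (g t) - (\<Sum>i\<in>I. w i * (sn k (dist a b) * md k t))"
      by (simp add: f_def sum_distrib_left sum_subtractf[symmetric] algebra_simps)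
    also have "\<dots> = sn k (dist a b) * (f (g t) - md k t)" by (simp add: wsum algebra_simps)
    finally have "(\<Sum>i\<in>I. w i * (sn k (dist a b - t) * md k (dist a (x i)) + sn k t * (md k (dist b (x i)) - md k (dist a b))))
      \<le> sn k (dist a b) * (f (g t) - md k t)" .
    moreover have "(\<Sum>i\<in>I. w i * (sn k (dist a b - t) * md k (dist a (x i)) + sn k t * (md k (dist b (x i)) - md k (dist a b))))
      = sn k (dist a b - t) * f a + sn k t * f b - (\<Sum>i\<in>I. w i * (sn k t * md k (dist a b)))"
      by (simp add: f_def sum_distrib_left sum_subtractf[symmetric] sum.distrib[symmetric] algebra_simps)
    ultimately show ?thesis by (simp add: wsum algebra_simps)
  qed
  have Esum: "(\<Sum>i\<in>I. w i * E z i) = V - 2 * f z - k\<^sup>2 * (f z)\<^sup>2" for z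
  proof -
    have "(\<Sum>i\<in>I. w i * E z i) = (\<Sum>i\<in>I. w i * f (x i) - w i * md k (dist z (x i)) - w i * f z
        - k\<^sup>2 * f z * (w i * md k (dist z (x i))))"
      by (intro sum.cong) (auto simp: E_def cosh_eq_md algebra_simps)
    also have "\<dots> = (\<Sum>i\<in>I. w i * f (x i)) - f z - f z - k\<^sup>2 * f z * f z"
      by (simp add: sum_subtractf wsum sum_distrib_left[symmetric] f_def[of z, symmetric])
    also have "(\<Sum>i\<in>I. w i * f (x i)) = V"
      by (simp add: V_def f_def sum_distrib_left mult_ac)
    finally show ?thesis by (simp add: power2_eq_square)
  qed
  have lip: "f z - f p \<le> L * dist p z" if z: "dist p z \<le> 1" for z
  proof -
    have "w i * md k (dist z (x i)) - w i * md k (dist p (x i)) \<le> w i * sn k (dist p (x i) + 1) * dist p z"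
      if i: "i \<in> I" for i
    proof -
      have "md k (dist z (x i)) - md k (dist p (x i)) \<le> sn k (dist z (x i)) * (dist z (x i) - dist p (x i))"
        using md_tangent[of k "dist z (x i)" "dist p (x i)"] by (simp add: algebra_simps)
      also have "\<dots> \<le> sn k (dist z (x i)) * dist p z"
        using dist_triangle[of z "x i" p] by (intro mult_left_mono sn_nonneg) (auto simp: dist_commute)
      also have "\<dots> \<le> sn k (dist p (x i) + 1) * dist p z"
        using dist_triangle[of z "x i" p] z by (intro mult_right_mono sn_mono) (auto simp: dist_commute)
      finally show ?thesis using mult_left_mono[OF _ w0[OF i]] by (fastforce simp: algebra_simps)
    qed
    hence "(\<Sum>i\<in>I. w i * md k (dist z (x i)) - w i * md k (dist p (x i))) \<le> (\<Sum>i\<in>I. w i * sn k (dist p (x i) + 1) * dist p z)"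
      by (rule sum_mono)
    thus ?thesis by (simp add: f_def L_def sum_subtractf sum_distrib_right)
  qed
  \<comment> \<open>Local one-sided Lipschitz constants of f at p; \<open>lip\<close> shows that L
    is one of them. Their infimum G is the upper slope, cut off at 0.\<close>
  define slopes where "slopes = {l. 0 \<le> l \<and> (\<exists>\<rho>>0. \<forall>z. dist p z < \<rho> \<longrightarrow> f z - f p \<le> l * dist p z)}"
  define G where "G = Inf slopes"
  have Lin: "L \<in> slopes" unfolding slopes_def using lip L0 by (auto intro!: exI[of _ 1])
  have bdds: "bdd_below slopes" by (auto simp: slopes_def intro!: bdd_belowI[of _ 0])
  have G0: "0 \<le> G" unfolding G_def using Lin by (intro cInf_greatest) (auto simp: slopes_def)
  have Gup: "\<exists>\<rho>>0. \<forall>z. dist p z < \<rho> \<longrightarrow> f z - f p \<le> (G + e) * dist p z" if "e > 0" for e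
  proof -
    have "Inf slopes < G + e" using that by (simp add: G_def)
    then obtain l where l: "l \<in> slopes" "l < G + e" using cInf_lessD[of slopes "G + e"] Lin by auto
    then obtain \<rho> where \<rho>: "\<rho> > 0" "\<And>z. dist p z < \<rho> \<Longrightarrow> f z - f p \<le> l * dist p z" by (auto simp: slopes_def)
    have "f z - f p \<le> (G + e) * dist p z" if "dist p z < \<rho>" for z
      using \<rho>(2)[OF that] mult_right_mono[of l "G + e" "dist p z"] l(2) by simp
    thus ?thesis using \<rho>(1) by blast
  qed
  have Glow: "\<exists>z. dist p z < \<rho> \<and> f z - f p > (G - e) * dist p z" if e: "e > 0" "e \<le> G" and \<rho>: "\<rho> > 0" for e \<rho>
  proof (rule ccontr)
    assume "\<not> ?thesis"
    hence "\<forall>z. dist p z < \<rho> \<longrightarrow> f z - f p \<le> (G - e) * dist p z" by (meson not_less)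
    hence "G - e \<in> slopes" unfolding slopes_def using e \<rho> by auto
    hence "G \<le> G - e" unfolding G_def by (rule cInf_lower[OF _ bdds])
    thus False using e by simp
  qed
  have "V \<le> 2 * f p + k\<^sup>2 * (f p)\<^sup>2"
  proof (cases "G = 0")
    case True
    \<comment> \<open>With zero slope there is no direction to move in, but then the derivative of f
      towards each \<open>x i\<close> is already at most every e > 0.\<close>
    have Ee: "E p i \<le> e * sn k (dist p (x i))" if e: "e > 0" for e i
    proof (cases "x i = p")
      case True thus ?thesis by (simp add: E_def)
    next
      case False
      define D where "D = dist p (x i)"
      have D: "D > 0" using False by (simp add: D_def)
      obtain g where g: "geodesic_path UNIV dist g p (x i)"
        using cbb by (auto simp: CBB_def geodesic_space_def)
      obtain \<rho> where \<rho>: "\<rho> > 0" "\<And>z. dist p z < \<rho> \<Longrightarrow> f z - f p \<le> e * dist p z"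
        using Gup[OF e] \<open>G = 0\<close> by auto
      define T where "T t = sn k D * (f p + e * t - md k t) - sn k (D - t) * f p - sn k t * (f (x i) - md k D)" for t
      have "(T has_real_derivative (sn k D * e + cosh (k * D) * f p - (f (x i) - md k D))) (at 0)"
        unfolding T_def by (auto intro!: derivative_eq_intros)
      hence "0 \<le> sn k D * e + cosh (k * D) * f p - (f (x i) - md k D)"
      proof (rule DERIV_right_minimum)
        show "0 < min D (\<rho> / 2)" using D \<rho> by simp
        fix t assume t: "t \<in> {0..min D (\<rho> / 2)}"
        have "dist p (g t) = t" using geodesic_pathD(4)[OF g, of t] t by (simp add: D_def)
        hence "f (g t) \<le> f p + e * t" using \<rho>(2)[of "g t"] t \<rho>(1) by auto
        hence "sn k D * (f (g t) - md k t) \<le> sn k D * (f p + e * t - md k t)"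
          using D by (intro mult_left_mono sn_nonneg) auto
        moreover have "sn k (D - t) * f p + sn k t * (f (x i) - md k D) \<le> sn k D * (f (g t) - md k t)"
          using concave[OF g, of t] t by (simp add: D_def)
        ultimately show "T 0 \<le> T t" by (simp add: T_def)
      qed
      thus ?thesis by (simp add: E_def D_def algebra_simps)
    qed
    have bound: "V - 2 * f p - k\<^sup>2 * (f p)\<^sup>2 \<le> e * (\<Sum>i\<in>I. w i * sn k (dist p (x i)))" if "e > 0" for e
      unfolding Esum[symmetric] sum_distrib_left using Ee[OF that] w0
      by (intro sum_mono) (metis mult.left_commute mult_left_mono)
    have "((\<lambda>e. e * (\<Sum>i\<in>I. w i * sn k (dist p (x i)))) \<longlongrightarrow> 0 * (\<Sum>i\<in>I. w i * sn k (dist p (x i)))) (at_right 0)"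
      by (intro tendsto_intros)
    hence "V - 2 * f p - k\<^sup>2 * (f p)\<^sup>2 \<le> 0 * (\<Sum>i\<in>I. w i * sn k (dist p (x i)))"
      by (rule tendsto_lowerbound) (use bound in \<open>auto simp: eventually_at_right_less intro: eventually_mono[OF eventually_at_right_less]\<close>)
    thus ?thesis by simp
  next
    case False
    hence Gpos: "G > 0" using G0 by simp
    \<comment> \<open>The argument runs at a point z close to p, which turns \<open>f p\<close> into
      \<open>f p + \<theta>\<close>. The last term collects the errors, and \<theta> tends to 0 at
      the end.\<close>
    have main: "V \<le> 2 * (f p + \<theta>) + k\<^sup>2 * (f p + \<theta>)\<^sup>2 + 10 * \<theta> * G * L" if \<theta>: "0 < \<theta>" "\<theta> \<le> 1/2" for \<theta>
    proof -
      \<comment> \<open>chosen so that \<epsilon> r is negligible against the step s = \<theta> r below, and s against r\<close>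
      define \<epsilon> where "\<epsilon> = \<theta>\<^sup>2 * G"
      define M where "M = f p + L"
      have \<theta>2: "\<theta>\<^sup>2 \<le> 1/4" using power_mono[OF \<theta>(2), of 2] \<theta> by (simp add: power2_eq_square)
      have \<epsilon>: "\<epsilon> > 0" "4 * \<epsilon> \<le> G" using Gpos \<theta> \<theta>2 by (auto simp: \<epsilon>_def mult_le_cancel_right2 algebra_simps)
      obtain \<rho>0 where \<rho>0: "\<rho>0 > 0" "\<And>z. dist p z < \<rho>0 \<Longrightarrow> f z - f p \<le> (G + \<epsilon>) * dist p z"
        using Gup[OF \<epsilon>(1)] by auto
      have M0: "0 \<le> k\<^sup>2 * M" using f0[of p] L0 by (simp add: M_def)
      have lims: "((\<lambda>r. cosh (k * r)) \<longlongrightarrow> cosh (k * 0)) (at_right 0)"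
        "((\<lambda>r. sn k r * (1 + k\<^sup>2 * M)) \<longlongrightarrow> sn k 0 * (1 + k\<^sup>2 * M)) (at_right 0)"
        "((\<lambda>r. L * r) \<longlongrightarrow> L * 0) (at_right 0)"
        unfolding sn_def by (cases "k = 0"; auto intro!: tendsto_eq_intros)+
      have ev: "\<forall>\<^sub>F r in at_right 0. cosh (k * r) < 2" "\<forall>\<^sub>F r in at_right 0. sn k r * (1 + k\<^sup>2 * M) < \<epsilon>"
        "\<forall>\<^sub>F r in at_right 0. L * r < \<theta>"
        using order_tendstoD(2)[OF lims(1), of 2] order_tendstoD(2)[OF lims(2), of \<epsilon>]
          order_tendstoD(2)[OF lims(3), of \<theta>] \<epsilon> \<theta> by auto
      have "\<forall>\<^sub>F r in at_right 0. \<forall>i\<in>I. x i \<noteq> p \<longrightarrow> r < dist p (x i)"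
        by (intro eventually_ball_finite[OF fin] ballI)
           (auto intro: order_tendstoD(2)[OF tendsto_ident_at])
      moreover have "\<forall>\<^sub>F r in at_right (0::real). r < \<rho>0" "\<forall>\<^sub>F r in at_right (0::real). r < 1"
        using \<rho>0(1) by (auto intro: order_tendstoD(2)[OF tendsto_ident_at])
      ultimately have "\<forall>\<^sub>F r in at_right 0. 0 < r \<and> cosh (k * r) < 2 \<and> sn k r * (1 + k\<^sup>2 * M) < \<epsilon> \<and> L * r < \<theta>
          \<and> (\<forall>i\<in>I. x i \<noteq> p \<longrightarrow> r < dist p (x i)) \<and> r < \<rho>0 \<and> r < 1"
        using ev eventually_at_right_less[of 0] by eventually_elim auto
      \<comment> \<open>M bounds f near p, so the condition with \<open>sn\<close> makes
        second-order terms at scale r at most \<open>\<epsilon> * r\<close>. The lower bound on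
        \<open>dist p (x i)\<close> guarantees that a step of length at most r from z towards
        \<open>x i\<close> stays on the geodesic.\<close>
      from eventually_happens'[OF trivial_limit_at_right_real this] obtain \<rho> where \<rho>: "\<rho> > 0" "cosh (k * \<rho>) < 2" "sn k \<rho> * (1 + k\<^sup>2 * M) < \<epsilon>" "L * \<rho> < \<theta>"
        "\<And>i. i \<in> I \<Longrightarrow> x i \<noteq> p \<Longrightarrow> \<rho> < dist p (x i)" "\<rho> < \<rho>0" "\<rho> < 1"
        by blast
      obtain z' where z': "dist p z' < \<rho>" "f z' - f p > (G - \<epsilon>) * dist p z'"
        using Glow[OF \<epsilon>(1) _ \<rho>(1)] \<epsilon> by auto
      \<comment> \<open>Geodesics in a CBB space need not be prolongable. Taking z as the midpoint
        of p and z' provides a continuation of the geodesic from p beyond z, along which f can be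
        tested.\<close>
      define r where "r = dist p z' / 2"
      have "z' \<noteq> p" using z'(2) by auto
      hence r: "r > 0" "dist p z' = 2 * r" "2 * r < \<rho>" using z' by (auto simp: r_def)
      obtain g where g: "geodesic_path UNIV dist g p z'"
        using cbb by (auto simp: CBB_def geodesic_space_def)
      define z where "z = g r"
      note G1 = geodesic_pathD[OF g, unfolded r(2)]
      have pz: "dist p z = r" using G1(4)[of r] r by (simp add: z_def)
      have zz': "dist z z' = r" using G1(5)[of r] r by (simp add: z_def)
      have fzM: "f z \<le> M"
        using lip[of z] pz r \<rho> L0 mult_left_mono[of r 1 L] by (simp add: M_def)
      define c n where "c = cosh (k * r)" and "n = md k r"
      have c: "c = 1 + k\<^sup>2 * n" "c \<le> 2" "1 \<le> c"
        using cosh_mono[of r \<rho> k] r \<rho> by (auto simp: c_def n_def cosh_eq_md cosh_real_ge_1)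
      have sr: "sn k r > 0" "r \<le> sn k r" using r sn_pos sn_ge by auto
      have n: "n + k\<^sup>2 * n * f z \<le> \<epsilon> * r" "0 \<le> n"
      proof -
        show "0 \<le> n" by (simp add: n_def)
        have "n * (1 + k\<^sup>2 * f z) \<le> (r * sn k r) * (1 + k\<^sup>2 * M)"
          using md_le_mult_sn[of k r] fzM f0[of z] r sr by (intro mult_mono add_left_mono mult_left_mono) (auto simp: n_def)
        also have "\<dots> \<le> r * (sn k \<rho> * (1 + k\<^sup>2 * M))"
          using sn_mono[of r \<rho> k] r \<rho> M0 by (simp add: mult_left_mono mult_right_mono)
        also have "\<dots> \<le> r * \<epsilon>" using \<rho> r by (intro mult_left_mono) auto
        finally show "n + k\<^sup>2 * n * f z \<le> \<epsilon> * r" by (simp add: algebra_simps)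
      qed
      have fz: "f z - f p \<ge> (G - 2 * \<epsilon>) * r"
      proof -
        have "sn k (2 * r) * (f z - n) \<ge> sn k r * f p + sn k r * (f z' - md k (2 * r))"
          using concave[OF g, of r] r by (simp add: z_def n_def)
        hence "sn k r * (2 * c * (f z - n)) \<ge> sn k r * (f p + (f z' - 2 * n * (1 + c)))"
          unfolding sn_double md_double c_def[symmetric] n_def[symmetric] by (simp add: algebra_simps)
        hence "2 * c * (f z - n) \<ge> f p + (f z' - 2 * n * (1 + c))" using sr by simp
        hence "2 * f z + 2 * (k\<^sup>2 * n * f z + n) \<ge> f p + f z'" by (simp add: c(1) algebra_simps)
        moreover have "f z' \<ge> f p + (G - \<epsilon>) * (2 * r)" using z'(2) r by simp
        ultimately show ?thesis using n by (simp add: algebra_simps)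
      qed
      define s where "s = \<theta> * r"
      have s: "0 < s" "s \<le> r" using \<theta> r by (auto simp: s_def mult_le_cancel_right2)
      have ss: "0 < sn k s" "s \<le> sn k s" using s sn_pos sn_ge by auto
      define D where "D i = dist z (x i)" for i
      have Dr: "r \<le> D i" if i: "i \<in> I" for i
      proof (cases "x i = p")
        case True thus ?thesis using pz by (simp add: D_def dist_commute)
      next
        case False
        thus ?thesis using \<rho>(5)[OF i] dist_triangle[of p "x i" z] pz r by (simp add: D_def)
      qed
      have "\<exists>u. dist z u = s \<and> dist u (x i) = D i - s \<and> sn k (D i) * (f u - f z) \<ge> sn k s * E z i" if i: "i \<in> I" for i
      proof -
        obtain h where h: "geodesic_path UNIV dist h z (x i)"
          using cbb by (auto simp: CBB_def geodesic_space_def)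
        have sD: "s \<in> {0..D i}" using s Dr[OF i] by simp
        have "sn k (D i) * (f (h s) - md k s) \<ge> sn k (D i - s) * f z + sn k s * (f (x i) - md k (D i))"
          using concave[OF h, of s] sD by (simp add: D_def)
        moreover have "sn k (D i - s) * f z \<ge> (sn k (D i) - sn k s * cosh (k * D i)) * f z"
          using sn_diff_le[of s "D i" k] sD f0[of z] by (intro mult_right_mono) auto
        moreover have "0 \<le> sn k (D i) * md k s" using sD by (intro mult_nonneg_nonneg sn_nonneg) auto
        ultimately have "sn k (D i) * (f (h s) - f z) \<ge> sn k s * E z i"
          by (simp add: E_def D_def algebra_simps)
        thus ?thesis using geodesic_pathD(4,5)[OF h, of s] sD by (intro exI[of _ "h s"]) (auto simp: D_def)
      qed
      then obtain u where u: "\<And>i. i \<in> I \<Longrightarrow> dist z (u i) = s" "\<And>i. i \<in> I \<Longrightarrow> dist (u i) (x i) = D i - s"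
        "\<And>i. i \<in> I \<Longrightarrow> sn k (D i) * (f (u i) - f z) \<ge> sn k s * E z i" by metis
      define d where "d i = dist p (u i)" for i
      \<comment> \<open>The CBB comparison for the triangle p, \<open>g (r + \<sigma>)\<close>,
        \<open>u i\<close> with z inside the opposite side, solved for the far endpoint: a lower
        bound at the interior point becomes an upper bound for \<open>md\<close> between
        \<open>u i\<close> and \<open>g (r + \<sigma>)\<close>.\<close>
      define R where "R i \<sigma> = md k (r + \<sigma>) + (sn k (r + \<sigma>) * (md k s - n) - sn k \<sigma> * md k (d i)) / sn k r" for i \<sigma>
      define R' where "R' i = sn k r + (c * (md k s - n) - md k (d i)) / sn k r" for i
      have R0: "R i 0 = md k s" for i using sr by (simp add: R_def n_def field_simps)
      have dR: "(R i has_real_derivative R' i) (at 0)" for i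
        unfolding R_def R'_def using sr by (auto intro!: derivative_eq_intros simp: c_def)
      define T where "T \<sigma> = (\<Sum>i\<in>I. w i * md k (D i + (R i \<sigma> - md k s) / sn k s))" for \<sigma>
      define Q where "Q \<sigma> = md k \<sigma> + (sn k (r - \<sigma>) * f z + sn k \<sigma> * (f z' - n)) / sn k r" for \<sigma>
      \<comment> \<open>T bounds \<open>f (g (r + \<sigma>))\<close> from above by routing distances
        through the \<open>u i\<close>, Q from below by concavity between z and z'. Both equal
        \<open>f z\<close> at \<sigma> = 0.\<close>
      have TQ: "T 0 - Q 0 \<le> T \<sigma> - Q \<sigma>" if \<sigma>: "\<sigma> \<in> {0..r}" for \<sigma>
      proof -
        have "T 0 = f z" by (simp add: T_def R0 f_def D_def)
        moreover have "Q 0 = f z" using sr by (simp add: Q_def)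
        moreover have "Q \<sigma> \<le> f (g (r + \<sigma>))"
        proof -
          have "geodesic_path UNIV dist (\<lambda>t. g (r + t)) z z'"
            using geodesic_path_sub(1)[OF g, of r "2 * r"] r G1(2) by (simp add: z_def)
          from concave[OF this, of \<sigma>] have "sn k (r - \<sigma>) * f z + sn k \<sigma> * (f z' - n) \<le> sn k r * (f (g (r + \<sigma>)) - md k \<sigma>)"
            using \<sigma> by (simp add: zz' n_def)
          thus ?thesis using sr by (simp add: Q_def field_simps)
        qed
        moreover have "f (g (r + \<sigma>)) \<le> T \<sigma>"
        proof -
          have "dist (g (r + \<sigma>)) (x i) \<le> D i + (R i \<sigma> - md k s) / sn k s" if i: "i \<in> I" for i
          proof -
            have pd: "dist p (g (r + \<sigma>)) = r + \<sigma>" using G1(4)[of "r + \<sigma>"] \<sigma> r by simp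
            have "geodesic_path UNIV dist g p (g (r + \<sigma>))"
              using geodesic_path_sub(1)[OF g, of 0 "r + \<sigma>"] r \<sigma> G1(1) by simp
            from CBB_comparison[OF cbb this, of r "u i"]
            have "sn k \<sigma> * md k (d i) + sn k r * (md k (dist (u i) (g (r + \<sigma>))) - md k (r + \<sigma>))
              \<le> sn k (r + \<sigma>) * (md k s - n)"
              using \<sigma> r u(1)[OF i] by (simp add: pd z_def[symmetric] n_def d_def dist_commute)
            hence "md k (dist (u i) (g (r + \<sigma>))) \<le> R i \<sigma>" using sr by (simp add: R_def field_simps)
            hence "sn k s * (dist (u i) (g (r + \<sigma>)) - s) \<le> R i \<sigma> - md k s"
              using md_tangent[of k s "dist (u i) (g (r + \<sigma>))"] by simp
            hence "dist (u i) (g (r + \<sigma>)) - s \<le> (R i \<sigma> - md k s) / sn k s"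
              using ss by (simp add: field_simps)
            thus ?thesis using dist_triangle[of "g (r + \<sigma>)" "x i" "u i"] u(2)[OF i] by (simp add: dist_commute)
          qed
          thus ?thesis unfolding f_def T_def using w0 by (intro sum_mono mult_left_mono md_mono) auto
        qed
        ultimately show ?thesis by simp
      qed
      have "((\<lambda>\<sigma>. T \<sigma> - Q \<sigma>) has_real_derivative
          ((\<Sum>i\<in>I. w i * (sn k (D i) * (R' i / sn k s))) - (f z' - n - c * f z) / sn k r)) (at 0)"
        unfolding T_def Q_def using sr ss dR
        by (auto intro!: derivative_eq_intros sum.cong simp: R0 c_def field_simps)
      hence "0 \<le> (\<Sum>i\<in>I. w i * (sn k (D i) * (R' i / sn k s))) - (f z' - n - c * f z) / sn k r"
        by (rule DERIV_right_minimum) (use r(1) TQ in auto)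
      \<comment> \<open>Up to a positive factor this is the derivative of Q at 0: f keeps growing
        past z. The margin is what \<open>4 * \<epsilon> \<le> G\<close> leaves over the
        second-order terms.\<close>
      moreover have "0 \<le> f z' - n - c * f z"
      proof -
        have "f z' - f z \<ge> (G - 3 * \<epsilon>) * r"
          using z'(2) \<rho>0(2)[of z] pz r \<rho> by (simp add: algebra_simps)
        moreover have "(G - 3 * \<epsilon>) * r \<ge> \<epsilon> * r" using \<epsilon> r by (intro mult_right_mono) auto
        ultimately show ?thesis using n by (simp add: c(1) algebra_simps)
      qed
      ultimately have pos: "0 \<le> (\<Sum>i\<in>I. w i * (sn k (D i) * (R' i / sn k s)))"
        using sr by (smt (verit) divide_nonneg_pos)
      \<comment> \<open>Up to errors, \<open>R' i\<close> is at most \<open>r - d i\<close>. As f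
        rises from p to \<open>u i\<close> with slope at most \<open>G + \<epsilon>\<close>, the
        gain \<open>d i - r\<close> is in turn bounded below by the increase of f towards
        \<open>x i\<close>, hence by \<open>E z i\<close>. The errors amount to 4 from
        \<open>2 * \<theta>\<close> times \<open>G + \<epsilon> \<le> 2 * G\<close>, and 3 from
        \<epsilon> r = \<theta> G s.\<close>
      have K: "(G + \<epsilon>) * (sn k (D i) * (R' i / sn k s)) \<le> 10 * \<theta> * G * sn k (dist p (x i) + 1) - E z i" if i: "i \<in> I" for i
      proof -
        have Dpos: "0 < D i" using Dr[OF i] r by simp
        have sD: "0 < sn k (D i)" using Dpos by (rule sn_pos)
        have "sn k r * R' i = n + c * md k s - md k (d i)"
          using sn_sq[of k r] sr by (simp add: R'_def c(1) n_def field_simps power2_eq_square)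
        also have "\<dots> \<le> c * md k s - sn k r * (d i - r)" using md_tangent[of k r "d i"] by (simp add: n_def)
        also have "c * md k s \<le> sn k r * (2 * \<theta> * sn k s)"
        proof -
          have "c * md k s \<le> 2 * (s * sn k s)" using c md_le_mult_sn[of k s] s ss by (intro mult_mono) auto
          also have "\<dots> = r * (2 * \<theta> * sn k s)" by (simp add: s_def)
          also have "\<dots> \<le> sn k r * (2 * \<theta> * sn k s)" using sr \<theta> ss by (intro mult_right_mono) auto
          finally show ?thesis .
        qed
        finally have "sn k r * R' i \<le> sn k r * (2 * \<theta> * sn k s - (d i - r))" by (simp add: algebra_simps)
        hence R': "R' i \<le> 2 * \<theta> * sn k s - (d i - r)" using sr by simp
        have "d i \<le> r + s" using dist_triangle[of p "u i" z] pz u(1)[OF i] by (simp add: d_def)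
        hence "d i < \<rho>0" using s r \<rho> by simp
        hence "f (u i) - f p \<le> (G + \<epsilon>) * d i" using \<rho>0(2) by (simp add: d_def)
        hence dr: "(G + \<epsilon>) * (d i - r) \<ge> f (u i) - f z - 3 * \<epsilon> * r" using fz by (simp add: algebra_simps)
        have "(G + \<epsilon>) * (sn k (D i) * R' i) \<le> (G + \<epsilon>) * (sn k (D i) * (2 * \<theta> * sn k s - (d i - r)))"
          using R' sD Gpos \<epsilon> by (intro mult_left_mono) auto
        also have "\<dots> = (G + \<epsilon>) * (2 * \<theta> * sn k s * sn k (D i)) - sn k (D i) * ((G + \<epsilon>) * (d i - r))"
          by (simp add: algebra_simps)
        also have "\<dots> \<le> (G + \<epsilon>) * (2 * \<theta> * sn k s * sn k (D i)) - sn k (D i) * (f (u i) - f z - 3 * \<epsilon> * r)"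
          using dr sD by (intro diff_left_mono mult_left_mono) auto
        also have "\<dots> \<le> (G + \<epsilon>) * (2 * \<theta> * sn k s * sn k (D i)) - sn k s * E z i + sn k (D i) * (3 * \<epsilon> * r)"
          using u(3)[OF i] by (simp add: algebra_simps)
        also have "sn k (D i) * (3 * \<epsilon> * r) \<le> 3 * \<theta> * G * sn k s * sn k (D i)"
        proof -
          have "3 * \<epsilon> * r = 3 * \<theta> * G * s" by (simp add: \<epsilon>_def s_def power2_eq_square)
          also have "\<dots> \<le> 3 * \<theta> * G * sn k s" using \<theta> Gpos ss by (intro mult_left_mono) auto
          finally show ?thesis using sD by (simp add: mult_left_mono mult.commute)
        qed
        also have "(G + \<epsilon>) * (2 * \<theta> * sn k s * sn k (D i)) \<le> (2 * G) * (2 * \<theta> * sn k s * sn k (D i))"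
          using \<epsilon> Gpos \<theta> ss sD by (intro mult_right_mono) auto
        finally have "(G + \<epsilon>) * (sn k (D i) * R' i) \<le> sn k s * (7 * \<theta> * G * sn k (D i) - E z i)"
          by (simp add: algebra_simps)
        hence "(G + \<epsilon>) * (sn k (D i) * (R' i / sn k s)) \<le> 7 * \<theta> * G * sn k (D i) - E z i"
          using ss by (simp add: field_simps)
        also have "7 * \<theta> * G * sn k (D i) \<le> 10 * \<theta> * G * sn k (dist p (x i) + 1)"
        proof -
          have "D i \<le> dist p (x i) + 1" using dist_triangle[of z "x i" p] pz r \<rho> by (simp add: D_def dist_commute)
          thus ?thesis using \<theta> Gpos sD by (intro mult_mono sn_mono) auto
        qed
        finally show ?thesis by simp
      qed
      have "0 \<le> (G + \<epsilon>) * (\<Sum>i\<in>I. w i * (sn k (D i) * (R' i / sn k s)))"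
        using pos Gpos \<epsilon> by simp
      also have "\<dots> = (\<Sum>i\<in>I. w i * ((G + \<epsilon>) * (sn k (D i) * (R' i / sn k s))))"
        by (simp add: sum_distrib_left mult_ac)
      also have "\<dots> \<le> (\<Sum>i\<in>I. w i * (10 * \<theta> * G * sn k (dist p (x i) + 1) - E z i))"
        using K w0 by (intro sum_mono mult_left_mono) auto
      also have "\<dots> = 10 * \<theta> * G * L - (V - 2 * f z - k\<^sup>2 * (f z)\<^sup>2)"
        unfolding Esum[symmetric] L_def by (simp add: sum_distrib_left sum_subtractf algebra_simps)
      finally have "V \<le> 2 * f z + k\<^sup>2 * (f z)\<^sup>2 + 10 * \<theta> * G * L" by simp
      moreover have "f z \<le> f p + \<theta>"
        using lip[of z] pz r \<rho> L0 mult_left_mono[of r \<rho> L] by simp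
      moreover have "k\<^sup>2 * (f z)\<^sup>2 \<le> k\<^sup>2 * (f p + \<theta>)\<^sup>2"
        using calculation(2) f0[of z] by (intro mult_left_mono power_mono) auto
      ultimately show ?thesis by simp
    qed
    have "((\<lambda>\<theta>. 2 * (f p + \<theta>) + k\<^sup>2 * (f p + \<theta>)\<^sup>2 + 10 * \<theta> * G * L) \<longlongrightarrow>
      2 * (f p + 0) + k\<^sup>2 * (f p + 0)\<^sup>2 + 10 * 0 * G * L) (at_right 0)"
      by (intro tendsto_intros)
    moreover have "\<forall>\<^sub>F \<theta> in at_right 0. V \<le> 2 * (f p + \<theta>) + k\<^sup>2 * (f p + \<theta>)\<^sup>2 + 10 * \<theta> * G * L"
      using eventually_at_right_real[of 0 "1/2"] by (rule eventually_mono) (use main in auto)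
    ultimately have "V \<le> 2 * (f p + 0) + k\<^sup>2 * (f p + 0)\<^sup>2 + 10 * 0 * G * L"
      by (rule tendsto_lowerbound) simp
    thus ?thesis by simp
  qed
  thus ?thesis by (simp add: V_def f_def)
qed

section \<open>Extension of short maps\<close>

lemma closed_md_ball: "closed {q::'b::metric_space. md k (dist q y) \<le> c}"
  by (intro closed_Collect_le continuous_intros)

text \<open>Finite intersections form a directed family of closed midconvex sets. Keeping one index
  \<open>i0\<close> in all of them puts every member inside a single bounded ball.\<close>

lemma CAT_ball_intersection:
  fixes y :: "'i \<Rightarrow> 'b::complete_space" and c :: "'i \<Rightarrow> real" and W :: "'i \<Rightarrow> 'i \<Rightarrow> real"
  assumes cat: "\<kappa> \<le> 0" "k = sqrt (- \<kappa>)" "CAT \<kappa> TYPE('b)"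
    and c0: "\<And>i. i \<in> J \<Longrightarrow> 0 \<le> c i"
    and W: "\<And>i j. i \<in> J \<Longrightarrow> j \<in> J \<Longrightarrow> md k (dist (y i) (y j)) \<le> W i j"
    and LSS: "\<And>I w. finite I \<Longrightarrow> I \<subseteq> J \<Longrightarrow> (\<And>i. i \<in> I \<Longrightarrow> 0 \<le> w i) \<Longrightarrow> (\<Sum>i\<in>I. w i) = 1 \<Longrightarrow>
      (\<Sum>i\<in>I. \<Sum>j\<in>I. w i * w j * W i j) \<le> 2 * (\<Sum>i\<in>I. w i * c i) + k\<^sup>2 * (\<Sum>i\<in>I. w i * c i)\<^sup>2"
  shows "\<exists>q. \<forall>i\<in>J. md k (dist q (y i)) \<le> c i"
proof (cases "J = {}")
  case False
  then obtain i0 where i0: "i0 \<in> J" by blast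
  define B where "B I = {q. \<forall>i\<in>I. md k (dist q (y i)) \<le> c i}" for I
  define F where "F = B ` {I. finite I \<and> I \<subseteq> J \<and> i0 \<in> I}"
  have "\<Inter>F \<noteq> {}"
  proof (rule midconvex_directed_Inter)
    show "\<exists>m. strong_midpoint k a b m" for a b :: 'b using CAT_strong_midpoint[OF cat] by metis
    show "F \<noteq> {}" unfolding F_def using i0 by (auto intro: exI[of _ "{i0}"])
    have BI: "B I = \<Inter>((\<lambda>i. {q. md k (dist q (y i)) \<le> c i}) ` I)" for I by (auto simp: B_def)
    show "closed C" if "C \<in> F" for C
      using that unfolding F_def BI by (auto intro!: closed_INT closed_md_ball)
    show "midconvex k C" if "C \<in> F" for C
      using that unfolding F_def BI
      by (auto intro!: midconvex_Inter midconvex_sublevel)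
         (use strong_midpoint_md in \<open>simp add: dist_commute\<close>)
    show "\<exists>E\<in>F. E \<subseteq> C \<inter> D" if "C \<in> F" "D \<in> F" for C D
    proof -
      obtain I I' where "finite I" "I \<subseteq> J" "i0 \<in> I" "C = B I" "finite I'" "I' \<subseteq> J" "i0 \<in> I'" "D = B I'"
        using \<open>C \<in> F\<close> \<open>D \<in> F\<close> by (auto simp: F_def)
      thus ?thesis by (intro bexI[of _ "B (I \<union> I')"]) (auto simp: F_def B_def)
    qed
    show "\<exists>x\<in>C. dist (y i0) x \<le> sqrt (2 * c i0)" if C: "C \<in> F" for C
    proof -
      obtain I where I: "finite I" "I \<subseteq> J" "i0 \<in> I" "C = B I" using C by (auto simp: F_def)
      have "\<exists>q. \<forall>i\<in>I. md k (dist q (y i)) \<le> c i"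
        using I by (intro CAT_finite_ball_intersection[OF cat I(1), where W = W] c0 W LSS) auto
      then obtain q where q: "\<forall>i\<in>I. md k (dist q (y i)) \<le> c i" by blast
      hence "(dist (y i0) q)\<^sup>2 \<le> 2 * c i0"
        using md_ge[of "dist q (y i0)" k] I(3) by (force simp: dist_commute)
      hence "dist (y i0) q \<le> sqrt (2 * c i0)" by (rule real_le_rsqrt)
      thus ?thesis using q I by (auto simp: B_def)
    qed
  qed
  then obtain q where q: "q \<in> \<Inter>F" by blast
  have "md k (dist q (y i)) \<le> c i" if "i \<in> J" for i
  proof -
    have "B {i0, i} \<in> F" using i0 that by (auto simp: F_def)
    thus ?thesis using q by (auto simp: B_def)
  qed
  thus ?thesis by blast
qed simp

text \<open>Zorn's lemma runs over short relations instead of functions: \<open>C p p = 0\<close>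
  already forces them to be single-valued. Totality of a maximal one is the common point of the
  balls of \<open>md\<close> radius \<open>C p i\<close>, so S needs only a cost, not a
  metric.\<close>

lemma CAT_short_map_extension:
  fixes f :: "'p \<Rightarrow> 'b::complete_space" and C :: "'p \<Rightarrow> 'p \<Rightarrow> real"
  assumes cat: "\<kappa> \<le> 0" "k = sqrt (- \<kappa>)" "CAT \<kappa> TYPE('b)"
    and DS: "D \<subseteq> S"
    and C_refl: "\<And>p. p \<in> S \<Longrightarrow> C p p = 0"
    and C_sym: "\<And>p q. p \<in> S \<Longrightarrow> q \<in> S \<Longrightarrow> C p q = C q p"
    and C_nonneg: "\<And>p q. p \<in> S \<Longrightarrow> q \<in> S \<Longrightarrow> 0 \<le> C p q"
    and short: "\<And>p q. p \<in> D \<Longrightarrow> q \<in> D \<Longrightarrow> md k (dist (f p) (f q)) \<le> C p q"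
    and LSS: "\<And>p I w. p \<in> S \<Longrightarrow> finite I \<Longrightarrow> I \<subseteq> S \<Longrightarrow> (\<And>i. i \<in> I \<Longrightarrow> 0 \<le> w i) \<Longrightarrow> (\<Sum>i\<in>I. w i) = 1 \<Longrightarrow>
      (\<Sum>i\<in>I. \<Sum>j\<in>I. w i * w j * C i j) \<le> 2 * (\<Sum>i\<in>I. w i * C p i) + k\<^sup>2 * (\<Sum>i\<in>I. w i * C p i)\<^sup>2"
  obtains F where "\<And>p. p \<in> D \<Longrightarrow> F p = f p"
    "\<And>p q. p \<in> S \<Longrightarrow> q \<in> S \<Longrightarrow> md k (dist (F p) (F q)) \<le> C p q"
proof -
  define short_graph where "short_graph G \<longleftrightarrow> (\<forall>p b q c. (p, b) \<in> G \<longrightarrow> (q, c) \<in> G \<longrightarrow> md k (dist b c) \<le> C p q)"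
    for G :: "('p \<times> 'b) set"
  define P where "P = {G. fst ` G \<subseteq> S \<and> (\<lambda>p. (p, f p)) ` D \<subseteq> G \<and> short_graph G}"
  have "\<exists>M\<in>P. \<forall>X\<in>P. M \<subseteq> X \<longrightarrow> X = M"
  proof (rule subset_Zorn_nonempty)
    show "P \<noteq> {}"
      using DS short by (auto simp: P_def short_graph_def intro!: exI[of _ "(\<lambda>p. (p, f p)) ` D"])
    fix \<C> assume ne: "\<C> \<noteq> {}" and ch: "subset.chain P \<C>"
    hence sub: "\<C> \<subseteq> P" and lin: "\<And>X Y. X \<in> \<C> \<Longrightarrow> Y \<in> \<C> \<Longrightarrow> X \<subseteq> Y \<or> Y \<subseteq> X"
      by (auto simp: subset_chain_def)
    have "short_graph (\<Union>\<C>)" unfolding short_graph_def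
    proof (intro allI impI)
      fix p b q c assume "(p, b) \<in> \<Union>\<C>" "(q, c) \<in> \<Union>\<C>"
      then obtain X Y where XY: "X \<in> \<C>" "(p, b) \<in> X" "Y \<in> \<C>" "(q, c) \<in> Y" by blast
      then obtain Z where "Z \<in> \<C>" "(p, b) \<in> Z" "(q, c) \<in> Z" using lin[of X Y] by blast
      thus "md k (dist b c) \<le> C p q" using sub by (auto simp: P_def short_graph_def)
    qed
    moreover have "fst ` \<Union>\<C> \<subseteq> S" using sub unfolding P_def by fastforce
    moreover have "(\<lambda>p. (p, f p)) ` D \<subseteq> \<Union>\<C>" using sub ne by (auto simp: P_def)
    ultimately show "\<Union>\<C> \<in> P" by (simp add: P_def)
  qed
  then obtain M where M: "M \<in> P" "\<And>X. X \<in> P \<Longrightarrow> M \<subseteq> X \<Longrightarrow> X = M" by blast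
  define F where "F p = (SOME b. (p, b) \<in> M)" for p
  have F: "(p, F p) \<in> M" if "(p, b) \<in> M" for p b unfolding F_def using that by (rule someI)
  have MS: "p \<in> S" if "(p, b) \<in> M" for p b using M(1) that by (force simp: P_def)
  have Mshort: "md k (dist b c) \<le> C p q" if "(p, b) \<in> M" "(q, c) \<in> M" for p b q c
    using M(1) that by (auto simp: P_def short_graph_def)
  have dom: "i \<in> S" "(i, F i) \<in> M" if "i \<in> fst ` M" for i
    using that MS F by (metis imageE prod.collapse)+
  have uniq: "b = F p" if "(p, b) \<in> M" for p b
  proof -
    have "md k (dist b (F p)) \<le> 0" using Mshort[OF that F[OF that]] C_refl[OF MS[OF that]] by simp
    thus ?thesis using md_eq_0_iff[of "dist b (F p)" k] md_nonneg[of k "dist b (F p)"] by auto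
  qed
  have total: "(p, F p) \<in> M" if p: "p \<in> S" for p
  proof -
    have "\<exists>q. \<forall>i\<in>fst ` M. md k (dist q (F i)) \<le> C p i"
    proof (rule CAT_ball_intersection[OF cat, where W = C])
      show "0 \<le> C p i" if "i \<in> fst ` M" for i using C_nonneg[OF p dom(1)[OF that]] .
      show "md k (dist (F i) (F j)) \<le> C i j" if "i \<in> fst ` M" "j \<in> fst ` M" for i j
        using Mshort[OF dom(2)[OF that(1)] dom(2)[OF that(2)]] .
      fix I and w :: "'p \<Rightarrow> real"
      assume I: "finite I" "I \<subseteq> fst ` M" "\<And>i. i \<in> I \<Longrightarrow> 0 \<le> w i" "(\<Sum>i\<in>I. w i) = 1"
      have "I \<subseteq> S" using I(2) dom(1) by blast
      thus "(\<Sum>i\<in>I. \<Sum>j\<in>I. w i * w j * C i j) \<le> 2 * (\<Sum>i\<in>I. w i * C p i) + k\<^sup>2 * (\<Sum>i\<in>I. w i * C p i)\<^sup>2"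
        using LSS[OF p I(1) _ I(3,4)] by simp
    qed
    then obtain q where q: "\<And>i. i \<in> fst ` M \<Longrightarrow> md k (dist q (F i)) \<le> C p i" by blast
    have q': "md k (dist q b) \<le> C p i" if "(i, b) \<in> M" for i b
      using q[OF image_eqI[OF _ that]] uniq[OF that] by simp
    have "short_graph (insert (p, q) M)" unfolding short_graph_def
    proof (intro allI impI)
      fix i b j c assume "(i, b) \<in> insert (p, q) M" "(j, c) \<in> insert (p, q) M"
      then consider "(i, b) \<in> M" "(j, c) \<in> M" | "(i, b) = (p, q)" "(j, c) = (p, q)"
        | "(i, b) = (p, q)" "(j, c) \<in> M" | "(i, b) \<in> M" "(j, c) = (p, q)" by blast
      thus "md k (dist b c) \<le> C i j"
        by cases (use Mshort C_refl[OF p] q' C_sym[OF p] MS in \<open>auto simp: dist_commute\<close>)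
    qed
    hence "insert (p, q) M \<in> P" using M(1) p by (auto simp: P_def)
    hence "(p, q) \<in> M" using M(2)[of "insert (p, q) M"] by blast
    thus ?thesis using uniq by blast
  qed
  show ?thesis
  proof (rule that[of F])
    show "F p = f p" if "p \<in> D" for p
      using M(1) that uniq[of p "f p"] by (auto simp: P_def)
    show "md k (dist (F p) (F q)) \<le> C p q" if "p \<in> S" "q \<in> S" for p q
      using Mshort total that by blast
  qed
qed

text \<open>The pseudometric collapses the ball of radius t around the base point, rescales the result by a factor growing with t, and takes the supremum over t.\<close>

lemma weighted_pseudometric_exists:
  fixes \<delta> :: "'g \<Rightarrow> 'g \<Rightarrow> real" and u :: "'g \<Rightarrow> real"
  assumes sym: "\<And>g h. \<delta> g h = \<delta> h g" and refl: "\<And>g. g \<in> N \<Longrightarrow> \<delta> g g = 0"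
    and nonneg: "\<And>g h. g \<in> N \<Longrightarrow> h \<in> N \<Longrightarrow> 0 \<le> \<delta> g h" "\<And>g. g \<in> N \<Longrightarrow> 0 \<le> u g"
    and tri: "\<And>g h l. g \<in> N \<Longrightarrow> h \<in> N \<Longrightarrow> l \<in> N \<Longrightarrow> \<delta> g l \<le> \<delta> g h + \<delta> h l"
    and u: "\<And>g h. g \<in> N \<Longrightarrow> h \<in> N \<Longrightarrow> u g \<le> u h + \<delta> g h"
      "\<And>g h. g \<in> N \<Longrightarrow> h \<in> N \<Longrightarrow> \<delta> g h \<le> u g + u h"
  obtains \<rho> :: "'g \<Rightarrow> 'g \<Rightarrow> real" where
    "\<And>g h. \<rho> g h = \<rho> h g" "\<And>g. g \<in> N \<Longrightarrow> \<rho> g g = 0" "\<And>g h. g \<in> N \<Longrightarrow> h \<in> N \<Longrightarrow> 0 \<le> \<rho> g h"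
    "\<And>g h l. g \<in> N \<Longrightarrow> h \<in> N \<Longrightarrow> l \<in> N \<Longrightarrow> \<rho> g l \<le> \<rho> g h + \<rho> h l"
    "\<And>g h. g \<in> N \<Longrightarrow> h \<in> N \<Longrightarrow> \<rho> g h \<le> 4 * sn k (4 * max (u g) (u h)) * \<delta> g h"
    "\<And>g h. g \<in> N \<Longrightarrow> h \<in> N \<Longrightarrow> sn k (2 * max (u g) (u h)) * \<delta> g h \<le> \<rho> g h"
proof -
  define d where "d t g h = min (\<delta> g h) (max 0 (u g - t) + max 0 (u h - t))" for t g h
  \<comment> \<open>The weight is matched to t = v / 2 with v the larger size: there it equals 4
    sn(2v), and the 4 compensates the loss in passing from \<delta> to \<open>d\<close>. For t
    beyond both sizes \<open>d\<close> vanishes, so the supremum is finite.\<close>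
  define T where "T t g h = 4 * sn k (4 * t) * d t g h" for t g h
  define \<rho> where "\<rho> g h = (SUP t\<in>{0..}. T t g h)" for g h
  have d0: "0 \<le> d t g h" if "g \<in> N" "h \<in> N" for t g h using nonneg(1)[OF that] by (simp add: d_def)
  have Tle: "T t g h \<le> 4 * sn k (4 * max (u g) (u h)) * \<delta> g h" if gh: "g \<in> N" "h \<in> N" and t: "t \<ge> 0" for t g h
  proof (cases "t \<le> max (u g) (u h)")
    case True
    have "sn k (4 * t) \<le> sn k (4 * max (u g) (u h))" using True by (intro sn_mono) auto
    thus ?thesis unfolding T_def using d0[OF gh] t sn_nonneg[of "4 * t" k]
      by (intro mult_mono) (auto simp: d_def)
  next
    case False
    hence "d t g h = 0" using nonneg(1)[OF gh] by (simp add: d_def)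
    moreover have "0 \<le> sn k (4 * max (u g) (u h))" using nonneg(2)[OF gh(1)] by (intro sn_nonneg) auto
    ultimately show ?thesis using nonneg(1)[OF gh] by (simp add: T_def)
  qed
  have bdd: "bdd_above ((\<lambda>t. T t g h) ` {0..})" if "g \<in> N" "h \<in> N" for g h
    using Tle[OF that] by (intro bdd_aboveI2) auto
  have up: "T t g h \<le> \<rho> g h" if "g \<in> N" "h \<in> N" "0 \<le> t" for t g h
    unfolding \<rho>_def using that by (intro cSUP_upper bdd) auto
  have least: "\<rho> g h \<le> c" if "\<And>t. 0 \<le> t \<Longrightarrow> T t g h \<le> c" for g h c
    unfolding \<rho>_def using that by (intro cSUP_least) auto
  show ?thesis
  proof (rule that[of \<rho>])
    show "\<rho> g h = \<rho> h g" for g h by (simp add: \<rho>_def T_def d_def sym[of g h] add.commute)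
    show "0 \<le> \<rho> g h" if "g \<in> N" "h \<in> N" for g h using up[OF that, of 0] by (simp add: T_def)
    then show "\<rho> g g = 0" if "g \<in> N" for g
      using that refl[OF that] by (intro antisym least) (auto simp: T_def d_def max_def min_def)
    show "\<rho> g h \<le> 4 * sn k (4 * max (u g) (u h)) * \<delta> g h" if "g \<in> N" "h \<in> N" for g h
      using Tle[OF that] by (rule least)
    show "\<rho> g l \<le> \<rho> g h + \<rho> h l" if N: "g \<in> N" "h \<in> N" "l \<in> N" for g h l
    proof (rule least)
      fix t :: real assume t: "0 \<le> t"
      have "d t g l \<le> d t g h + d t h l"
        using tri[OF N] u(1)[OF N(1,2)] u(1)[OF N(3,2)] sym[of l h] nonneg(1)[OF N(1,2)] nonneg(1)[OF N(2,3)]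
        unfolding d_def by (auto simp: min_def max_def)
      hence "T t g l \<le> T t g h + T t h l" unfolding T_def using t sn_nonneg[of "4 * t" k]
        by (simp add: distrib_left[symmetric] mult_left_mono)
      thus "T t g l \<le> \<rho> g h + \<rho> h l" using up[OF N(1,2) t] up[OF N(2,3) t] by simp
    qed
    show "sn k (2 * max (u g) (u h)) * \<delta> g h \<le> \<rho> g h" if N: "g \<in> N" "h \<in> N" for g h
    proof -
      define v where "v = max (u g) (u h)"
      have v: "0 \<le> v" using nonneg(2)[OF N(1)] by (simp add: v_def)
      \<comment> \<open>At t = v / 2 the larger map has excess v / 2, while \<delta> is at most the
        sum of the sizes, hence at most 2v.\<close>
      have "\<delta> g h \<le> 4 * d (v / 2) g h"
        using u(2)[OF N] nonneg(1)[OF N] nonneg(2)[OF N(1)] nonneg(2)[OF N(2)]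
        unfolding d_def v_def by (auto simp: min_def max_def)
      hence "sn k (2 * v) * \<delta> g h \<le> T (v / 2) g h"
        using mult_left_mono[of "\<delta> g h" "4 * d (v / 2) g h" "sn k (2 * v)"] sn_nonneg[of "2 * v" k] v
        by (simp add: T_def mult_ac)
      also have "\<dots> \<le> \<rho> g h" using v by (intro up N) auto
      finally show ?thesis by (simp add: v_def)
    qed
  qed
qed

section \<open>The space of bounded nonexpansive maps and the extension operator\<close>

lemma sup_dist_properties:
  fixes A :: "'a::metric_space set" and g h :: "'a \<Rightarrow> 'b::metric_space"
  assumes A: "A \<noteq> {}" and N: "g \<in> nonexp_maps A" "h \<in> nonexp_maps A"
  shows "a \<in> A \<Longrightarrow> dist (g a) (h a) \<le> sup_dist A g h"
    and "(\<And>a. a \<in> A \<Longrightarrow> dist (g a) (h a) \<le> c) \<Longrightarrow> sup_dist A g h \<le> c"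
    and "0 \<le> sup_dist A g h"
proof -
  \<comment> \<open>A real \<open>SUP\<close> is informative only for sets bounded above; this is
    where boundedness of the two maps enters.\<close>
  have "bdd_above ((\<lambda>a. dist (g a) (h a)) ` A)"
  proof -
    obtain x b where x: "\<And>y. y \<in> g ` A \<Longrightarrow> dist x y \<le> b"
      using N(1) unfolding nonexp_maps_def bounded_def by blast
    obtain x' b' where x': "\<And>y. y \<in> h ` A \<Longrightarrow> dist x' y \<le> b'"
      using N(2) unfolding nonexp_maps_def bounded_def by blast
    have "dist (g a) (h a) \<le> b + dist x x' + b'" if "a \<in> A" for a
      using dist_triangle[of "g a" "h a" x] dist_triangle[of x "h a" x'] x[of "g a"] x'[of "h a"] that
      by (simp add: dist_commute)
    thus ?thesis by (rule bdd_aboveI2)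
  qed
  thus up: "dist (g a) (h a) \<le> sup_dist A g h" if "a \<in> A" for a
    unfolding sup_dist_def using that by (rule cSUP_upper[rotated])
  show "0 \<le> sup_dist A g h" using A up zero_le_dist order_trans by blast
qed (use A in \<open>auto simp: sup_dist_def intro: cSUP_least\<close>)

theorem theorem3p6:
  fixes \<kappa> :: real and A :: "'a::metric_space set"
  assumes "\<kappa> \<le> 0"
    and "CBB \<kappa> TYPE('a)"
    and "CAT \<kappa> TYPE('b::complete_space)"
    and "A \<noteq> {}"
  shows "\<exists>\<alpha> :: ('a \<Rightarrow> 'b) \<Rightarrow> ('a \<Rightarrow> 'b).
           (\<forall>g\<in>nonexp_maps A. \<alpha> g \<in> nonexp_maps UNIV) \<and>
           (\<forall>f\<in>nonexp_maps A. \<forall>\<epsilon>>0. \<exists>\<delta>>0. \<forall>g\<in>nonexp_maps A.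
               sup_dist A f g < \<delta> \<longrightarrow> sup_dist UNIV (\<alpha> f) (\<alpha> g) < \<epsilon>) \<and>
           (\<forall>g\<in>nonexp_maps A. \<forall>a\<in>A. \<alpha> g a = g a)"
proof -
  define k where "k = sqrt (- \<kappa>)"
  define N where "N = (nonexp_maps A :: ('a \<Rightarrow> 'b) set)"
  obtain y0 :: 'b where True by simp
  define z :: "'a \<Rightarrow> 'b" where "z = (\<lambda>_. y0)"
  have z: "z \<in> N" by (simp add: N_def nonexp_maps_def z_def image_constant_conv)
  note sd = sup_dist_properties[where ?'b = 'b, OF assms(4), folded N_def]
  define u where "u g = sup_dist A g z" for g
  have tri: "sup_dist A g l \<le> sup_dist A g h + sup_dist A h l" if "g \<in> N" "h \<in> N" "l \<in> N" for g h l :: "'a \<Rightarrow> 'b"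
  proof (rule sd(2)[OF that(1,3)])
    fix a assume a: "a \<in> A"
    show "dist (g a) (l a) \<le> sup_dist A g h + sup_dist A h l"
      using dist_triangle[of "g a" "l a" "h a"] sd(1)[OF that(1,2) a] sd(1)[OF that(2,3) a] by simp
  qed
  have sym: "sup_dist A g h = sup_dist A h g" for g h :: "'a \<Rightarrow> 'b"
    by (simp add: sup_dist_def dist_commute)
  obtain \<rho> :: "('a \<Rightarrow> 'b) \<Rightarrow> ('a \<Rightarrow> 'b) \<Rightarrow> real" where
    \<rho>: "\<And>g h. \<rho> g h = \<rho> h g" "\<And>g. g \<in> N \<Longrightarrow> \<rho> g g = 0" "\<And>g h. g \<in> N \<Longrightarrow> h \<in> N \<Longrightarrow> 0 \<le> \<rho> g h"
      "\<And>g h l. g \<in> N \<Longrightarrow> h \<in> N \<Longrightarrow> l \<in> N \<Longrightarrow> \<rho> g l \<le> \<rho> g h + \<rho> h l"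
    and \<rho>_le: "\<And>g h. g \<in> N \<Longrightarrow> h \<in> N \<Longrightarrow> \<rho> g h \<le> 4 * sn k (4 * max (u g) (u h)) * sup_dist A g h"
    and \<rho>_ge: "\<And>g h. g \<in> N \<Longrightarrow> h \<in> N \<Longrightarrow> sn k (2 * max (u g) (u h)) * sup_dist A g h \<le> \<rho> g h"
  proof (rule weighted_pseudometric_exists[of "sup_dist A" N u k])
    show "sup_dist A g g = 0" if "g \<in> N" for g :: "'a \<Rightarrow> 'b"
      using that by (intro antisym sd) auto
    show "u g \<le> u h + sup_dist A g h" if "g \<in> N" "h \<in> N" for g h
      using tri[OF that z] by (simp add: u_def)
    show "sup_dist A g h \<le> u g + u h" if "g \<in> N" "h \<in> N" for g h
      using tri[OF that(1) z that(2)] sym[of z h] by (simp add: u_def)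
  qed (use sym tri sd(3) z in \<open>auto simp: u_def\<close>)
  define S :: "(('a \<Rightarrow> 'b) \<times> 'a) set" where "S = N \<times> UNIV"
  define C where "C p q = md k (dist (snd p) (snd q)) + \<rho> (fst p) (fst q)" for p q :: "('a \<Rightarrow> 'b) \<times> 'a"
  \<comment> \<open>Besides the given values, the constant map z is prescribed on all of X, so that
    every \<open>\<alpha> g\<close> can be compared with a constant and is bounded.\<close>
  define D where "D = N \<times> A \<union> {z} \<times> UNIV"
  \<comment> \<open>This dictates the weight of \<rho>: by convexity md(s) - md(t) is at most sn(s)
    (s - t), where s is at most \<open>u g + u h\<close> and s - t at most the uniform
    distance.\<close>
  have data: "md k (dist (g a) (h b)) \<le> md k (dist a b) + \<rho> g h" if gh: "g \<in> N" "h \<in> N" and ab: "a \<in> A" "b \<in> A" for g h a b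
  proof -
    define s t where "s = dist (g a) (h b)" and "t = dist a b"
    have "dist (h a) (h b) \<le> t" using gh(2) ab by (simp add: N_def nonexp_maps_def t_def)
    hence st: "s - t \<le> sup_dist A g h"
      using sd(1)[OF gh ab(1)] dist_triangle[of "g a" "h b" "h a"] by (simp add: s_def)
    have "s \<le> u g + u h"
      using sd(1)[OF gh(1) z ab(1)] sd(1)[OF gh(2) z ab(2)] dist_triangle2[of "g a" "h b" y0]
      by (simp add: s_def u_def z_def)
    hence "sn k s \<le> sn k (2 * max (u g) (u h))" by (intro sn_mono) auto
    have "md k s - md k t \<le> sn k s * (s - t)" using md_tangent[of k s t] by (simp add: algebra_simps)
    also have "\<dots> \<le> sn k s * sup_dist A g h" using st by (intro mult_left_mono sn_nonneg) (auto simp: s_def)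
    also have "\<dots> \<le> sn k (2 * max (u g) (u h)) * sup_dist A g h"
      using \<open>sn k s \<le> _\<close> sd(3)[OF gh] by (rule mult_right_mono)
    also have "\<dots> \<le> \<rho> g h" by (rule \<rho>_ge[OF gh])
    finally show ?thesis by (simp add: s_def t_def)
  qed
  obtain F where F: "\<And>p. p \<in> D \<Longrightarrow> F p = (case p of (g, a) \<Rightarrow> g a)"
    "\<And>p q. p \<in> S \<Longrightarrow> q \<in> S \<Longrightarrow> md k (dist (F p) (F q)) \<le> C p q"
  proof (rule CAT_short_map_extension[where C = C and D = D and S = S and f = "\<lambda>(g, a). g a",
        OF assms(1) k_def assms(3)])
    show "D \<subseteq> S" using z by (auto simp: D_def S_def)
    show "C p p = 0" if "p \<in> S" for p using that \<rho>(2) by (auto simp: C_def S_def)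
    show "C p q = C q p" for p q using \<rho>(1) by (simp add: C_def dist_commute)
    show "0 \<le> C p q" if "p \<in> S" "q \<in> S" for p q using that \<rho>(3) by (auto simp: C_def S_def)
    show "md k (dist (case p of (g, a) \<Rightarrow> g a) (case q of (g, a) \<Rightarrow> g a)) \<le> C p q" if pq: "p \<in> D" "q \<in> D" for p q
    proof -
      obtain g a h b where p: "p = (g, a)" "q = (h, b)" by (metis surj_pair)
      \<comment> \<open>Since z is constant, \<open>data\<close> can be used with both points equal
        to a. This bounds the cost by \<rho> alone and covers points of X outside A.\<close>
      have zdata: "md k (dist (g a) y0) \<le> md k t + \<rho> g z" if "g \<in> N" "a \<in> A" for g a t
        using data[OF that(1) z that(2,2)] md_nonneg[of k t] unfolding z_def dist_self md_0 by linarith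
      have 1: "(g \<in> N \<and> a \<in> A) \<or> g = z" "(h \<in> N \<and> b \<in> A) \<or> h = z" using pq by (auto simp: D_def p)
      show ?thesis
      proof (cases "g = z")
        case True
        show ?thesis
        proof (cases "h = z")
          case True thus ?thesis using \<open>g = z\<close> \<rho>(2)[OF z] by (simp add: p C_def z_def)
        next
          case False
          thus ?thesis using zdata[of h b "dist a b"] 1(2) True \<rho>(1)[of z h]
            by (simp add: p C_def z_def dist_commute)
        qed
      next
        case False
        show ?thesis
        proof (cases "h = z")
          case True thus ?thesis using zdata[of g a "dist a b"] 1(1) False by (simp add: p C_def z_def)
        next
          case False
          thus ?thesis using data[of g h a b] 1 \<open>g \<noteq> z\<close> by (simp add: p C_def)
        qed
      qed
    qed
    fix p I and w :: "('a \<Rightarrow> 'b) \<times> 'a \<Rightarrow> real"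
    assume p: "p \<in> S" and I: "finite I" "I \<subseteq> S" "\<And>i. i \<in> I \<Longrightarrow> 0 \<le> w i" "(\<Sum>i\<in>I. w i) = 1"
    define V where "V = (\<Sum>i\<in>I. \<Sum>j\<in>I. w i * w j * md k (dist (snd i) (snd j)))"
    define E where "E = (\<Sum>i\<in>I. w i * md k (dist (snd p) (snd i)))"
    define R where "R = (\<Sum>i\<in>I. w i * \<rho> (fst p) (fst i))"
    have V: "V \<le> 2 * E + k\<^sup>2 * E\<^sup>2"
      unfolding V_def E_def by (rule CBB_variance_inequality[OF assms(1) k_def assms(2) I(1,3,4)])
    \<comment> \<open>The triangle inequality through p makes the \<rho> part of the double sum at
      most 2R, exactly what the linear term on the right gains.\<close>
    have "(\<Sum>i\<in>I. \<Sum>j\<in>I. w i * w j * \<rho> (fst i) (fst j)) \<le> (\<Sum>i\<in>I. \<Sum>j\<in>I. w i * w j * (\<rho> (fst p) (fst i) + \<rho> (fst p) (fst j)))"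
    proof (intro sum_mono mult_left_mono)
      fix i j assume ij: "i \<in> I" "j \<in> I"
      hence "fst i \<in> N" "fst j \<in> N" using I(2) by (auto simp: S_def)
      thus "\<rho> (fst i) (fst j) \<le> \<rho> (fst p) (fst i) + \<rho> (fst p) (fst j)" "0 \<le> w i * w j"
        using ij \<rho>(4)[of "fst i" "fst p" "fst j"] \<rho>(1)[of "fst i" "fst p"] I(2,3) p by (auto simp: S_def)
    qed
    also have "\<dots> = R * (\<Sum>j\<in>I. w j) + (\<Sum>i\<in>I. w i) * R"
      unfolding R_def sum_product sum.distrib[symmetric] by (simp add: algebra_simps)
    also have "\<dots> = 2 * R" by (simp add: I(4))
    finally have "(\<Sum>i\<in>I. \<Sum>j\<in>I. w i * w j * C i j) \<le> V + 2 * R"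
      by (simp add: C_def V_def distrib_left sum.distrib)
    moreover have "(\<Sum>i\<in>I. w i * C p i) = E + R" by (simp add: C_def E_def R_def distrib_left sum.distrib)
    moreover have "k\<^sup>2 * E\<^sup>2 \<le> k\<^sup>2 * (E + R)\<^sup>2"
    proof -
      have "0 \<le> E" "0 \<le> R" unfolding E_def R_def using I p \<rho>(3)
        by (auto intro!: sum_nonneg mult_nonneg_nonneg simp: S_def)
      thus ?thesis by (intro mult_left_mono power_mono) auto
    qed
    ultimately show "(\<Sum>i\<in>I. \<Sum>j\<in>I. w i * w j * C i j) \<le> 2 * (\<Sum>i\<in>I. w i * C p i) + k\<^sup>2 * (\<Sum>i\<in>I. w i * C p i)\<^sup>2"
      using V by simp
  qed blast
  define \<alpha> where "\<alpha> g x = F (g, x)" for g x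
  have \<alpha>: "md k (dist (\<alpha> g x) (\<alpha> h y)) \<le> md k (dist x y) + \<rho> g h" if "g \<in> N" "h \<in> N" for g h x y
    using F(2)[of "(g, x)" "(h, y)"] that by (simp add: \<alpha>_def S_def C_def)
  have \<alpha>z: "\<alpha> z x = y0" for x using F(1)[of "(z, x)"] by (simp add: \<alpha>_def D_def z_def)
  have close: "dist (\<alpha> g x) (\<alpha> h x) \<le> sqrt (2 * \<rho> g h)" if "g \<in> N" "h \<in> N" for g h x
    using \<alpha>[OF that, of x x] md_ge[of "dist (\<alpha> g x) (\<alpha> h x)" k] by (intro real_le_rsqrt) simp
  have "\<alpha> g \<in> nonexp_maps UNIV" if g: "g \<in> N" for g
  proof -
    have "dist (\<alpha> g x) (\<alpha> g y) \<le> dist x y" for x y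
      using \<alpha>[OF g g, of x y] \<rho>(2)[OF g] by (simp add: md_le_iff)
    moreover have "bounded (range (\<alpha> g))"
      using close[OF g z] by (auto simp: bounded_def \<alpha>z dist_commute)
    ultimately show ?thesis by (simp add: nonexp_maps_def)
  qed
  moreover have "\<alpha> g a = g a" if "g \<in> N" "a \<in> A" for g a
    using F(1)[of "(g, a)"] that by (simp add: \<alpha>_def D_def)
  moreover have "\<exists>\<delta>>0. \<forall>g\<in>N. sup_dist A f g < \<delta> \<longrightarrow> sup_dist UNIV (\<alpha> f) (\<alpha> g) < \<epsilon>" if f: "f \<in> N" and \<epsilon>: "\<epsilon> > 0" for f \<epsilon>
  proof -
    define m where "m = 4 * sn k (4 * (u f + 1))"
    have uf: "0 \<le> u f" using sd(3)[OF f z] by (simp add: u_def)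
    have m: "m > 0" using uf by (auto simp: m_def intro!: sn_pos)
    \<comment> \<open>The bound 1 keeps \<open>u g\<close> below \<open>u f + 1\<close>, so that m
      dominates the weight of \<rho>. The other bound gives \<rho> \<le> \<epsilon>^2 / 8 and,
      through \<open>close\<close>, pointwise distance at most \<epsilon> / 2, which stays strictly
      below \<epsilon> after the supremum.\<close>
    define \<delta> where "\<delta> = min 1 (\<epsilon>\<^sup>2 / (8 * m))"
    have "sup_dist UNIV (\<alpha> f) (\<alpha> g) < \<epsilon>" if g: "g \<in> N" and fg: "sup_dist A f g < \<delta>" for g
    proof -
      have "u g \<le> u f + 1"
        using tri[OF g f z] fg sym[of g f] by (simp add: u_def \<delta>_def)
      hence "4 * sn k (4 * max (u f) (u g)) \<le> m" unfolding m_def by (intro mult_left_mono sn_mono) auto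
      hence "\<rho> f g \<le> m * sup_dist A f g"
        using \<rho>_le[OF f g] mult_right_mono[OF _ sd(3)[OF f g]] by fastforce
      also have "\<dots> \<le> m * (\<epsilon>\<^sup>2 / (8 * m))" using fg m by (intro mult_left_mono) (auto simp: \<delta>_def)
      also have "\<dots> = \<epsilon>\<^sup>2 / 8" using m by simp
      finally have "sqrt (2 * \<rho> f g) \<le> \<epsilon> / 2"
        using \<epsilon> by (intro real_le_lsqrt) (auto simp: power_divide)
      hence "dist (\<alpha> f x) (\<alpha> g x) \<le> \<epsilon> / 2" for x using close[OF f g, of x] by simp
      hence "sup_dist UNIV (\<alpha> f) (\<alpha> g) \<le> \<epsilon> / 2" unfolding sup_dist_def by (intro cSUP_least) auto
      thus ?thesis using \<epsilon> by simp
    qed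
    moreover have "\<delta> > 0" using m \<epsilon> by (simp add: \<delta>_def)
    ultimately show ?thesis by blast
  qed
  ultimately show ?thesis unfolding N_def by blast
qed

end
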